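(* Let $0\le s\in\mathbb{R}$ and let $H^s(\mathbb{R}^N)$ be equipped with the norm $$\|u\|_{H^s(\mathbb{R}^N)}=\big\|(1+4\pi^2|\cdot|^2)^{s/2}\mathcal{F}u\big\|_{L_2(\mathbb{R}^N)}$$ and corresponding inner product $\langle u,v\rangle_{H^s(\mathbb{R}^N)}=\int_{\mathbb{R}^N}(1+4\pi^2|\xi|^2)^s(\mathcal{F}u)(\xi)\overline{(\mathcal{F}v)(\xi)}\,d\xi$. Then for each $u\in L_2(\mathbb{R}^N)$ the element $E_s^*u$ is given by $$(E_s^*u)(x)=\mathcal{F}^{-1}\Big((1+4\pi^2|\cdot|^2)^{-s}\mathcal{F}u\Big)(x).$$
   Context: $N\in\mathbb{N}$; $L_2(\mathbb{R}^N)$ is the complex Lebesgue space with $\langle u,v\rangle_{L_2(\mathbb{R}^N)}=\int u\overline v\,dx$. The Fourier transform is $(\mathcal{F}u)(\xi)=\int_{\mathbb{R}^N}e^{-2\pi i\xi\cdot x}u(x)\,dx$ and $(\mathcal{F}^{-1}u)(x)=\int_{\mathbb{R}^N}e^{2\pi ix\cdot\xi}u(\xi)\,d\xi$, extended to bounded, mutually inverse operators on $L_2(\mathbb{R}^N)$. $H^s(\mathbb{R}^N)$ is the set of $u\in L_2(\mathbb{R}^N)$ with $\mathcal{F}^{-1}\big((1+4\pi^2|\cdot|^2)^{s/2}\mathcal{F}u\big)\in L_2(\mathbb{R}^N)$. $E_s:H^s(\mathbb{R}^N)\to L_2(\mathbb{R}^N)$, $E_su:=u$, is the embedding operator, and its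 adjoint $E_s^*:L_2(\mathbb{R}^N)\to H^s(\mathbb{R}^N)$ is defined by $\langle E_s^*u,v\rangle_{H^s(\mathbb{R}^N)}=\langle u,v\rangle_{L_2(\mathbb{R}^N)}$ for all $u\in L_2(\mathbb{R}^N)$, $v\in H^s(\mathbb{R}^N)$. *)

theory Defs
  imports "HOL-Analysis.Analysis"
begin

text \<open>
  Elements of \<open>L\<^sub>2\<close> are represented by square-integrable Lebesgue measurable functions; equality
  in \<open>L\<^sub>2\<close> is equality almost everywhere.
\<close>

definition L2_space :: "('a::euclidean_space \<Rightarrow> complex) set" where
  "L2_space = {u. u \<in> borel_measurable lebesgue \<and> integrable lebesgue (\<lambda>x. (cmod (u x))\<^sup>2)}"

definition L2_inner :: "('a::euclidean_space \<Rightarrow> complex) \<Rightarrow> ('a \<Rightarrow> complex) \<Rightarrow> complex" where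
  "L2_inner u v = (LINT x|lebesgue. u x * cnj (v x))"

definition L2_norm :: "('a::euclidean_space \<Rightarrow> complex) \<Rightarrow> real" where
  "L2_norm u = sqrt (LINT x|lebesgue. (cmod (u x))\<^sup>2)"

definition fourier_integral :: "('a::euclidean_space \<Rightarrow> complex) \<Rightarrow> 'a \<Rightarrow> complex" where
  "fourier_integral u \<xi> = (LINT x|lebesgue. exp (- 2 * pi * \<i> * of_real (\<xi> \<bullet> x)) * u x)"

definition inv_fourier_integral :: "('a::euclidean_space \<Rightarrow> complex) \<Rightarrow> 'a \<Rightarrow> complex" where
  "inv_fourier_integral u x = (LINT \<xi>|lebesgue. exp (2 * pi * \<i> * of_real (x \<bullet> \<xi>)) * u \<xi>)"

text \<open>
  \<open>T\<close> is a bounded linear operator on \<open>L\<^sub>2\<close> that extends \<open>T\<^sub>0\<close>, the latter being given on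
  \<open>L\<^sub>1 \<inter> L\<^sub>2\<close>. As \<open>L\<^sub>1 \<inter> L\<^sub>2\<close> is dense in \<open>L\<^sub>2\<close>, this determines \<open>T u\<close> up to null sets for
  every \<open>u\<close> in \<open>L\<^sub>2\<close>. Linearity and boundedness force \<open>T\<close> to respect equality almost everywhere.
\<close>

definition L2_bounded_extension ::
    "(('a::euclidean_space \<Rightarrow> complex) \<Rightarrow> ('a \<Rightarrow> complex)) \<Rightarrow>
     (('a \<Rightarrow> complex) \<Rightarrow> ('a \<Rightarrow> complex)) \<Rightarrow> bool" where
  "L2_bounded_extension T\<^sub>0 T \<longleftrightarrow>
     (\<forall>u\<in>L2_space. T u \<in> L2_space) \<and>
     (\<forall>u\<in>L2_space. \<forall>v\<in>L2_space. \<forall>a b.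
        AE x in lebesgue. T (\<lambda>y. a * u y + b * v y) x = a * T u x + b * T v x) \<and>
     (\<exists>C. \<forall>u\<in>L2_space. L2_norm (T u) \<le> C * L2_norm u) \<and>
     (\<forall>u\<in>L2_space. integrable lebesgue u \<longrightarrow> (AE x in lebesgue. T u x = T\<^sub>0 u x))"

text \<open>
  Both transforms are meaningful on \<open>L2_space\<close> only; outside of it their values are arbitrary.
\<close>

definition fourier :: "('a::euclidean_space \<Rightarrow> complex) \<Rightarrow> ('a \<Rightarrow> complex)" where
  "fourier = (SOME T. L2_bounded_extension fourier_integral T)"

definition inv_fourier :: "('a::euclidean_space \<Rightarrow> complex) \<Rightarrow> ('a \<Rightarrow> complex)" where
  "inv_fourier = (SOME T. L2_bounded_extension inv_fourier_integral T)"

definition bessel_weight :: "real \<Rightarrow> 'a::euclidean_space \<Rightarrow> real" where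
  "bessel_weight r \<xi> = (1 + 4 * pi\<^sup>2 * (norm \<xi>)\<^sup>2) powr r"

text \<open>
  Since the inverse transform is an operator on \<open>L\<^sub>2\<close>, the condition
  \<open>\<F>\<inverse> ((1 + 4\<pi>\<^sup>2|\<cdot>|\<^sup>2)\<^bsup>s/2\<^esup> \<F> u) \<in> L\<^sub>2\<close> includes that its argument lies in \<open>L\<^sub>2\<close>. This has
  to be spelled out because \<open>inv_fourier\<close> is a total function in HOL.
\<close>

definition sobolev_space :: "real \<Rightarrow> ('a::euclidean_space \<Rightarrow> complex) set" where
  "sobolev_space s = {u \<in> L2_space.
     (\<lambda>\<xi>. of_real (bessel_weight (s / 2) \<xi>) * fourier u \<xi>) \<in> L2_space \<and>
     inv_fourier (\<lambda>\<xi>. of_real (bessel_weight (s / 2) \<xi>) * fourier u \<xi>) \<in> L2_space}"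

definition sobolev_norm :: "real \<Rightarrow> ('a::euclidean_space \<Rightarrow> complex) \<Rightarrow> real" where
  "sobolev_norm s u = L2_norm (\<lambda>\<xi>. of_real (bessel_weight (s / 2) \<xi>) * fourier u \<xi>)"

definition sobolev_inner ::
    "real \<Rightarrow> ('a::euclidean_space \<Rightarrow> complex) \<Rightarrow> ('a \<Rightarrow> complex) \<Rightarrow> complex" where
  "sobolev_inner s u v =
     (LINT \<xi>|lebesgue. of_real (bessel_weight s \<xi>) * fourier u \<xi> * cnj (fourier v \<xi>))"

lemma sobolev_inner_self: "sobolev_inner s u u = of_real ((sobolev_norm s u)\<^sup>2)"
proof -
  have "of_real (bessel_weight s \<xi>) * fourier u \<xi> * cnj (fourier u \<xi>) =
      complex_of_real ((cmod (of_real (bessel_weight (s / 2) \<xi>) * fourier u \<xi>))\<^sup>2)" for \<xi>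
  proof -
    have "(bessel_weight (s / 2) \<xi>)\<^sup>2 = bessel_weight s \<xi>"
      by (simp add: bessel_weight_def power2_eq_square flip: powr_add)
    then show ?thesis
      by (simp only: norm_mult norm_of_real power_mult_distrib power2_abs of_real_mult
          complex_norm_square mult.assoc)
  qed
  then show ?thesis
    by (simp add: sobolev_inner_def sobolev_norm_def L2_norm_def del: of_real_power)
qed

definition sobolev_embedding ::
    "real \<Rightarrow> ('a::euclidean_space \<Rightarrow> complex) \<Rightarrow> ('a \<Rightarrow> complex)" where
  "sobolev_embedding s u = u"

text \<open>
  The adjoint of \<open>sobolev_embedding s\<close>, as an operator from \<open>L2_space\<close> to \<open>sobolev_space s\<close>. The
  defining property determines its values up to null sets.
\<close>

definition sobolev_embedding_adjoint ::
    "real \<Rightarrow> ('a::euclidean_space \<Rightarrow> complex) \<Rightarrow> ('a \<Rightarrow> complex)" where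
  "sobolev_embedding_adjoint s u =
     (SOME w. w \<in> sobolev_space s \<and>
        (\<forall>v\<in>sobolev_space s. sobolev_inner s w v = L2_inner u (sobolev_embedding s v)))"

end

theory Submission imports Defs "HOL-Probability.Characteristic_Functions"
begin

text \<open>
  Write \<open>\<F>\<close> for the Fourier transform on \<open>L\<^sub>2\<close> and \<open>w = \<F>\<inverse> ((1 + 4\<pi>\<^sup>2\<bar>\<xi>\<bar>\<^sup>2)\<^sup>-\<^sup>s \<F> u)\<close>. Since \<open>\<F>\<close> is
  unitary, \<open>w\<close> lies in \<open>H\<^sup>s\<close>, and for every \<open>v\<close> in \<open>H\<^sup>s\<close> the weight of the inner product cancels:
  \<open>\<langle>w, v\<rangle> = \<langle>\<F> u, \<F> v\<rangle> = \<langle>u, v\<rangle>\<close>, the first inner product being that of \<open>H\<^sup>s\<close> and the others those of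
  \<open>L\<^sub>2\<close>. So \<open>w\<close> has the defining property of the adjoint applied to \<open>u\<close>
  (\<open>sobolev_riesz_representative\<close>), and this property determines an element of \<open>H\<^sup>s\<close> up to null sets
  (\<open>sobolev_riesz_unique_AE\<close>).

  The substance is Plancherel's theorem on an arbitrary Euclidean space: a bounded extension of the
  Fourier integral from \<open>L\<^sub>1 \<inter> L\<^sub>2\<close> to \<open>L\<^sub>2\<close> exists, for either sign of the exponent, and the two
  extensions are unitary and inverse to each other. For integrable \<open>u\<close>, Fubini's theorem expresses
  the integral of \<open>\<bar>\<F> u\<bar>\<^sup>2\<close> against a Gaussian as a double integral of \<open>u(x) cnj (u(y))\<close> against a
  Gaussian kernel in \<open>x - y\<close> (\<open>gauss_weighted_plancherel\<close>). This gives \<open>\<parallel>\<F> u\<parallel> \<le> \<parallel>u\<parallel>\<close> on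
  \<open>L\<^sub>1 \<inter> L\<^sub>2\<close> (\<open>osc_integral_bessel\<close>), with equality for continuous \<open>u\<close> with compact support
  (\<open>osc_integral_isometry_cc\<close>). As such functions are dense (\<open>cc_function_dense\<close>) and \<open>L\<^sub>2\<close> is
  complete (\<open>L2_complete\<close>), the extension exists (\<open>osc_bounded_extension_exists\<close>), and every bounded
  extension is isometric (\<open>osc_extension_isometry\<close>). The extensions for the two signs are adjoint to
  each other by Fubini's theorem (\<open>osc_extension_adjoint\<close>); being isometric, they are mutually inverse
  (\<open>osc_extension_inverse\<close>).
\<close>

section \<open>The semi-inner product space of square-integrable functions\<close>

lemma L2_spaceD:
  assumes "u \<in> L2_space"
  shows L2_space_measurable: "u \<in> borel_measurable lebesgue"
    and L2_space_integrable_square: "integrable lebesgue (\<lambda>x. (cmod (u x))\<^sup>2)"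
  using assms by (auto simp: L2_space_def)

lemma L2_spaceI_bound:
  assumes "integrable lebesgue g" "u \<in> borel_measurable lebesgue"
    "\<And>x. (cmod (u x))\<^sup>2 \<le> g x"
  shows "u \<in> L2_space"
proof -
  have "(cmod (u x))\<^sup>2 \<le> \<bar>g x\<bar>" for x
    using assms(3)[of x] by linarith
  then have "integrable lebesgue (\<lambda>x. (cmod (u x))\<^sup>2)"
    by (intro Bochner_Integration.integrable_bound[OF assms(1)]) (use assms(2) in auto)
  then show ?thesis
    using assms(2) by (simp add: L2_space_def)
qed

lemma L2_space_lincomb:
  assumes u: "u \<in> L2_space" and v: "v \<in> L2_space"
  shows "(\<lambda>x. a * u x + b * v x) \<in> L2_space"
proof (rule L2_spaceI_bound)
  note [measurable] = L2_space_measurable[OF u] L2_space_measurable[OF v]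
  show "integrable lebesgue (\<lambda>x. 2 * (cmod a)\<^sup>2 * (cmod (u x))\<^sup>2 + 2 * (cmod b)\<^sup>2 * (cmod (v x))\<^sup>2)"
    using L2_space_integrable_square[OF u] L2_space_integrable_square[OF v] by simp
  show "(\<lambda>x. a * u x + b * v x) \<in> borel_measurable lebesgue"
    by measurable
  fix x
  have "cmod (a * u x + b * v x) \<le> cmod a * cmod (u x) + cmod b * cmod (v x)"
    by (metis norm_mult norm_triangle_ineq)
  then have "(cmod (a * u x + b * v x))\<^sup>2 \<le> (cmod a * cmod (u x) + cmod b * cmod (v x))\<^sup>2"
    by (intro power_mono) auto
  also have "\<dots> \<le> 2 * (cmod a * cmod (u x))\<^sup>2 + 2 * (cmod b * cmod (v x))\<^sup>2"
    using sum_squares_bound[of "cmod a * cmod (u x)" "cmod b * cmod (v x)"]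
    by (simp add: power2_sum)
  finally show "(cmod (a * u x + b * v x))\<^sup>2 \<le>
      2 * (cmod a)\<^sup>2 * (cmod (u x))\<^sup>2 + 2 * (cmod b)\<^sup>2 * (cmod (v x))\<^sup>2"
    by (simp add: power_mult_distrib mult_ac)
qed

lemma L2_space_diff: "u \<in> L2_space \<Longrightarrow> v \<in> L2_space \<Longrightarrow> (\<lambda>x. u x - v x) \<in> L2_space"
  using L2_space_lincomb[of u v 1 "-1"] by simp

lemma L2_space_add: "u \<in> L2_space \<Longrightarrow> v \<in> L2_space \<Longrightarrow> (\<lambda>x. u x + v x) \<in> L2_space"
  using L2_space_lincomb[of u v 1 1] by simp

lemma L2_space_bounded_mult:
  assumes u: "u \<in> L2_space" and m: "m \<in> borel_measurable lebesgue" and b: "\<And>x. cmod (m x) \<le> B"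
  shows "(\<lambda>x. m x * u x) \<in> L2_space"
proof (rule L2_spaceI_bound)
  note [measurable] = L2_space_measurable[OF u] m
  show "integrable lebesgue (\<lambda>x. B\<^sup>2 * (cmod (u x))\<^sup>2)"
    using L2_space_integrable_square[OF u] by simp
  show "(\<lambda>x. m x * u x) \<in> borel_measurable lebesgue"
    by measurable
  show "(cmod (m x * u x))\<^sup>2 \<le> B\<^sup>2 * (cmod (u x))\<^sup>2" for x
    using b[of x] by (simp add: norm_mult power_mult_distrib mult_right_mono power_mono)
qed

lemma borel_measurable_cnj [measurable (raw)]:
  assumes "f \<in> borel_measurable M"
  shows "(\<lambda>x. cnj (f x)) \<in> borel_measurable M"
  using measurable_compose[OF assms borel_measurable_continuous_onI[OF continuous_on_cnj[OF continuous_on_id]]]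
  by simp

lemma L2_inner_integrable:
  assumes u: "u \<in> L2_space" and v: "v \<in> L2_space"
  shows "integrable lebesgue (\<lambda>x. u x * cnj (v x))"
proof (rule Bochner_Integration.integrable_bound)
  note [measurable] = L2_space_measurable[OF u] L2_space_measurable[OF v]
  show "integrable lebesgue (\<lambda>x. (cmod (u x))\<^sup>2 + (cmod (v x))\<^sup>2)"
    using L2_space_integrable_square[OF u] L2_space_integrable_square[OF v] by simp
  show "(\<lambda>x. u x * cnj (v x)) \<in> borel_measurable lebesgue"
    by measurable
  have "cmod (u x) * cmod (v x) \<le> (cmod (u x))\<^sup>2 + (cmod (v x))\<^sup>2" for x
    using sum_squares_bound[of "cmod (u x)" "cmod (v x)"]
      mult_nonneg_nonneg[OF norm_ge_zero[of "u x"] norm_ge_zero[of "v x"]]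
    by linarith
  then show "AE x in lebesgue. norm (u x * cnj (v x)) \<le> norm ((cmod (u x))\<^sup>2 + (cmod (v x))\<^sup>2)"
    by (simp add: norm_mult)
qed

lemma L2_norm_nonneg [simp]: "0 \<le> L2_norm u"
  by (simp add: L2_norm_def)

lemma L2_norm_power2: "(L2_norm u)\<^sup>2 = (LINT x|lebesgue. (cmod (u x))\<^sup>2)"
  by (simp add: L2_norm_def)

lemma L2_inner_self: "L2_inner u u = of_real ((L2_norm u)\<^sup>2)"
  unfolding L2_norm_power2 L2_inner_def
  by (simp only: complex_norm_square[symmetric] integral_complex_of_real)

lemma L2_inner_commute: "L2_inner v u = cnj (L2_inner u v)"
proof -
  have "cnj (L2_inner u v) = (LINT x|lebesgue. cnj (u x * cnj (v x)))"
    unfolding L2_inner_def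
    by (rule Bochner_Integration.integral_cnj[symmetric])
  then show ?thesis
    by (simp add: L2_inner_def mult.commute)
qed

lemma L2_inner_lincomb_left:
  assumes "u \<in> L2_space" "v \<in> L2_space" "w \<in> L2_space"
  shows "L2_inner (\<lambda>x. a * u x + b * v x) w = a * L2_inner u w + b * L2_inner v w"
  using L2_inner_integrable[OF assms(1,3)] L2_inner_integrable[OF assms(2,3)]
  by (simp add: L2_inner_def distrib_right mult.assoc)

lemma L2_inner_diff_left:
  assumes "u \<in> L2_space" "v \<in> L2_space" "w \<in> L2_space"
  shows "L2_inner (\<lambda>x. u x - v x) w = L2_inner u w - L2_inner v w"
  using L2_inner_lincomb_left[OF assms, of 1 "-1"] by simp

lemma L2_inner_diff_right:
  assumes "u \<in> L2_space" "v \<in> L2_space" "w \<in> L2_space"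
  shows "L2_inner w (\<lambda>x. u x - v x) = L2_inner w u - L2_inner w v"
  using L2_inner_diff_left[OF assms] by (simp add: L2_inner_commute[of w])

lemma L2_inner_cong_AE:
  assumes "AE x in lebesgue. u x = u' x" "AE x in lebesgue. v x = v' x"
    "u \<in> L2_space" "v \<in> L2_space" "u' \<in> L2_space" "v' \<in> L2_space"
  shows "L2_inner u v = L2_inner u' v'"
  unfolding L2_inner_def
proof (rule integral_cong_AE)
  show "AE x in lebesgue. u x * cnj (v x) = u' x * cnj (v' x)"
    using assms(1,2) by eventually_elim simp
qed (use assms(3-) L2_inner_integrable in \<open>blast intro: borel_measurable_integrable\<close>)+

lemma L2_norm_cong_AE:
  assumes "AE x in lebesgue. u x = v x" "u \<in> borel_measurable lebesgue" "v \<in> borel_measurable lebesgue"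
  shows "L2_norm u = L2_norm v"
proof -
  have "(LINT x|lebesgue. (cmod (u x))\<^sup>2) = (LINT x|lebesgue. (cmod (v x))\<^sup>2)"
    using assms by (intro integral_cong_AE) auto
  then show ?thesis
    by (simp add: L2_norm_def)
qed

lemma L2_norm_eq_0_iff:
  assumes "u \<in> L2_space"
  shows "L2_norm u = 0 \<longleftrightarrow> (AE x in lebesgue. u x = 0)"
  using integral_nonneg_eq_0_iff_AE[OF L2_space_integrable_square[OF assms]]
  by (simp add: L2_norm_def)

lemma L2_Cauchy_Schwarz:
  assumes u: "u \<in> L2_space" and v: "v \<in> L2_space"
  shows "cmod (L2_inner u v) \<le> L2_norm u * L2_norm v"
proof -
  note [measurable] = L2_space_measurable[OF u] L2_space_measurable[OF v]
  have int: "integrable lebesgue (\<lambda>x. cmod (u x) * cmod (v x))"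
    using integrable_norm[OF L2_inner_integrable[OF u v]] by (simp add: norm_mult)
  define I where "I = (LINT x|lebesgue. cmod (u x) * cmod (v x))"
  have I0: "I \<ge> 0"
    by (simp add: I_def)
  have "ennreal (I\<^sup>2) = (\<integral>\<^sup>+x. ennreal (cmod (u x)) * ennreal (cmod (v x)) \<partial>lebesgue)\<^sup>2"
    using nn_integral_eq_integral[OF int] I0
    by (simp add: I_def ennreal_mult ennreal_power)
  also have "\<dots> \<le> (\<integral>\<^sup>+x. (ennreal (cmod (u x)))\<^sup>2 \<partial>lebesgue) * (\<integral>\<^sup>+x. (ennreal (cmod (v x)))\<^sup>2 \<partial>lebesgue)"
    by (rule Cauchy_Schwarz_nn_integral) measurable
  also have "\<dots> = ennreal ((L2_norm u)\<^sup>2 * (L2_norm v)\<^sup>2)"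
    using nn_integral_eq_integral[OF L2_space_integrable_square[OF u]]
      nn_integral_eq_integral[OF L2_space_integrable_square[OF v]]
    by (simp add: L2_norm_power2 ennreal_power ennreal_mult)
  finally have "I\<^sup>2 \<le> (L2_norm u * L2_norm v)\<^sup>2"
    by (simp add: power_mult_distrib)
  then have "I \<le> L2_norm u * L2_norm v"
    by (rule power2_le_imp_le) simp
  moreover have "cmod (L2_inner u v) \<le> I"
    unfolding L2_inner_def I_def using integral_norm_bound[of lebesgue "\<lambda>x. u x * cnj (v x)"]
    by (simp add: norm_mult)
  ultimately show ?thesis
    by simp
qed

lemma L2_norm_diff_power2:
  assumes u: "u \<in> L2_space" and v: "v \<in> L2_space"
  shows "(L2_norm (\<lambda>x. u x - v x))\<^sup>2 = (L2_norm u)\<^sup>2 - 2 * Re (L2_inner u v) + (L2_norm v)\<^sup>2"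
proof -
  have "of_real ((L2_norm (\<lambda>x. u x - v x))\<^sup>2) =
      (L2_inner u u - L2_inner v u) - (L2_inner u v - L2_inner v v)"
    unfolding L2_inner_self[symmetric] using u v
    by (simp add: L2_inner_diff_left L2_inner_diff_right L2_space_diff)
  then have "(L2_norm (\<lambda>x. u x - v x))\<^sup>2 =
      Re ((L2_inner u u - L2_inner v u) - (L2_inner u v - L2_inner v v))"
    by (metis Re_complex_of_real)
  then show ?thesis
    by (simp add: L2_inner_self L2_inner_commute[of v u] power2_eq_square)
qed

lemma L2_norm_cmult: "L2_norm (\<lambda>x. a * u x) = cmod a * L2_norm u"
  by (simp add: L2_norm_def norm_mult power_mult_distrib real_sqrt_mult)

lemma L2_norm_diff_commute: "L2_norm (\<lambda>x. u x - v x) = L2_norm (\<lambda>x. v x - u x)"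
  by (simp add: L2_norm_def norm_minus_commute)

lemma L2_norm_triangle_diff:
  assumes u: "u \<in> L2_space" and v: "v \<in> L2_space"
  shows "L2_norm (\<lambda>x. u x - v x) \<le> L2_norm u + L2_norm v"
proof (rule power2_le_imp_le)
  show "(L2_norm (\<lambda>x. u x - v x))\<^sup>2 \<le> (L2_norm u + L2_norm v)\<^sup>2"
    using L2_Cauchy_Schwarz[OF u v] abs_Re_le_cmod[of "L2_inner u v"]
    unfolding L2_norm_diff_power2[OF u v] power2_sum by linarith
qed simp

lemma L2_norm_triangle:
  assumes u: "u \<in> L2_space" and v: "v \<in> L2_space"
  shows "L2_norm (\<lambda>x. u x + v x) \<le> L2_norm u + L2_norm v"
proof -
  have "(\<lambda>x. - v x) \<in> L2_space"
    using L2_space_lincomb[OF v v, of "-1" 0] by simp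
  then show ?thesis
    using L2_norm_triangle_diff[OF u, of "\<lambda>x. - v x"] by (simp add: L2_norm_def)
qed

lemma L2_dist_triangle:
  assumes "u \<in> L2_space" "v \<in> L2_space" "w \<in> L2_space"
  shows "L2_norm (\<lambda>x. u x - w x) \<le> L2_norm (\<lambda>x. u x - v x) + L2_norm (\<lambda>x. v x - w x)"
  using L2_norm_triangle[OF L2_space_diff[OF assms(1,2)] L2_space_diff[OF assms(2,3)]] by simp

lemma L2_norm_reverse_triangle:
  assumes u: "u \<in> L2_space" and v: "v \<in> L2_space"
  shows "\<bar>L2_norm u - L2_norm v\<bar> \<le> L2_norm (\<lambda>x. u x - v x)"
  using L2_norm_triangle[OF L2_space_diff[OF u v] v] L2_norm_triangle_diff[OF u L2_space_diff[OF u v]]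
  by simp

text \<open>
  Norm convergence in \<open>L\<^sub>2\<close>. Membership of all terms and of the limit is part of the notion, since
  \<open>L2_norm\<close> is a meaningful number only on \<open>L2_space\<close>. The limit is determined up to null sets.
\<close>

section \<open>Convergence in the mean\<close>

definition L2_tendsto :: "(nat \<Rightarrow> 'a::euclidean_space \<Rightarrow> complex) \<Rightarrow> ('a \<Rightarrow> complex) \<Rightarrow> bool" where
  "L2_tendsto f u \<longleftrightarrow> (\<forall>n. f n \<in> L2_space) \<and> u \<in> L2_space \<and>
     (\<lambda>n. L2_norm (\<lambda>x. f n x - u x)) \<longlonglongrightarrow> 0"

lemma L2_tendsto_norm:
  assumes "L2_tendsto f u"
  shows "(\<lambda>n. L2_norm (f n)) \<longlonglongrightarrow> L2_norm u"
proof -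
  have "(\<lambda>n. L2_norm (f n) - L2_norm u) \<longlonglongrightarrow> 0"
  proof (rule Lim_null_comparison)
    show "(\<lambda>n. L2_norm (\<lambda>x. f n x - u x)) \<longlonglongrightarrow> 0"
      using assms by (simp add: L2_tendsto_def)
    show "\<forall>\<^sub>F n in sequentially. norm (L2_norm (f n) - L2_norm u) \<le> L2_norm (\<lambda>x. f n x - u x)"
      using assms by (intro always_eventually allI) (simp add: L2_tendsto_def L2_norm_reverse_triangle)
  qed
  then show ?thesis
    by (rule LIM_zero_cancel)
qed

lemma L2_tendsto_inner:
  assumes f: "L2_tendsto f u" and g: "L2_tendsto g v"
  shows "(\<lambda>n. L2_inner (f n) (g n)) \<longlonglongrightarrow> L2_inner u v"
proof -
  have fs: "f n \<in> L2_space" "u \<in> L2_space" "g n \<in> L2_space" "v \<in> L2_space" for n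
    using f g by (auto simp: L2_tendsto_def)
  define h where "h n = L2_norm (\<lambda>x. f n x - u x) * L2_norm (g n) +
    L2_norm u * L2_norm (\<lambda>x. g n x - v x)" for n
  have "h \<longlonglongrightarrow> 0 * L2_norm v + L2_norm u * 0"
    unfolding h_def using f g L2_tendsto_norm[OF g]
    by (intro tendsto_intros) (auto simp: L2_tendsto_def)
  then have h0: "h \<longlonglongrightarrow> 0"
    by simp
  have "cmod (L2_inner (f n) (g n) - L2_inner u v) \<le> h n" for n
  proof -
    have "L2_inner (f n) (g n) - L2_inner u v =
        L2_inner (\<lambda>x. f n x - u x) (g n) + L2_inner u (\<lambda>x. g n x - v x)"
      using fs by (simp add: L2_inner_diff_left L2_inner_diff_right)
    then have "cmod (L2_inner (f n) (g n) - L2_inner u v) \<le>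
        cmod (L2_inner (\<lambda>x. f n x - u x) (g n)) + cmod (L2_inner u (\<lambda>x. g n x - v x))"
      by (simp add: norm_triangle_ineq)
    also have "\<dots> \<le> h n"
      unfolding h_def using fs by (intro add_mono L2_Cauchy_Schwarz L2_space_diff)
    finally show ?thesis .
  qed
  then have "(\<lambda>n. L2_inner (f n) (g n) - L2_inner u v) \<longlonglongrightarrow> 0"
    by (intro Lim_null_comparison[OF _ h0]) auto
  then show ?thesis
    by (rule LIM_zero_cancel)
qed

lemma L2_tendsto_lincomb:
  assumes f: "L2_tendsto f u" and g: "L2_tendsto g v"
  shows "L2_tendsto (\<lambda>n x. a * f n x + b * g n x) (\<lambda>x. a * u x + b * v x)"
proof -
  have fs: "f n \<in> L2_space" "u \<in> L2_space" "g n \<in> L2_space" "v \<in> L2_space" for n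
    using f g by (auto simp: L2_tendsto_def)
  define h where "h n = cmod a * L2_norm (\<lambda>x. f n x - u x) + cmod b * L2_norm (\<lambda>x. g n x - v x)" for n
  have "h \<longlonglongrightarrow> cmod a * 0 + cmod b * 0"
    unfolding h_def using f g by (intro tendsto_intros) (auto simp: L2_tendsto_def)
  then have h0: "h \<longlonglongrightarrow> 0"
    by simp
  have "L2_norm (\<lambda>x. (a * f n x + b * g n x) - (a * u x + b * v x)) \<le> h n" for n
  proof -
    have "(\<lambda>x. (a * f n x + b * g n x) - (a * u x + b * v x)) =
        (\<lambda>x. a * (f n x - u x) + b * (g n x - v x))"
      by (simp add: algebra_simps)
    moreover have "(\<lambda>x. a * (f n x - u x)) \<in> L2_space" "(\<lambda>x. b * (g n x - v x)) \<in> L2_space"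
      using L2_space_lincomb[of "\<lambda>x. f n x - u x" "\<lambda>x. f n x - u x" a 0]
        L2_space_lincomb[of "\<lambda>x. g n x - v x" "\<lambda>x. g n x - v x" b 0] fs L2_space_diff by auto
    ultimately show ?thesis
      unfolding h_def using L2_norm_triangle[of "\<lambda>x. a * (f n x - u x)" "\<lambda>x. b * (g n x - v x)"]
      by (simp only: L2_norm_cmult)
  qed
  then have "(\<lambda>n. L2_norm (\<lambda>x. (a * f n x + b * g n x) - (a * u x + b * v x))) \<longlonglongrightarrow> 0"
    by (intro Lim_null_comparison[OF _ h0]) auto
  then show ?thesis
    using fs by (auto simp: L2_tendsto_def L2_space_lincomb)
qed

text \<open>
  Fatou's lemma for Bochner integrals of nonnegative real functions: integrability of the limit is
  part of the conclusion.
\<close>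

lemma integrable_Fatou:
  fixes f :: "nat \<Rightarrow> 'a \<Rightarrow> real"
  assumes int: "\<And>n. integrable M (f n)" and nn: "\<And>n x. 0 \<le> f n x"
    and le: "\<And>n. integral\<^sup>L M (f n) \<le> B"
    and F: "F \<in> borel_measurable M" and lim: "AE x in M. (\<lambda>n. f n x) \<longlonglongrightarrow> F x"
  shows "integrable M F" "integral\<^sup>L M F \<le> B"
proof -
  have B: "0 \<le> B"
    using le[of 0] Bochner_Integration.integral_nonneg[of M "f 0"] nn by (meson order_trans)
  have F0: "AE x in M. 0 \<le> F x"
    using lim by eventually_elim (use nn in \<open>auto intro: LIMSEQ_le_const\<close>)
  have "(\<integral>\<^sup>+x. ennreal (F x) \<partial>M) = (\<integral>\<^sup>+x. liminf (\<lambda>n. ennreal (f n x)) \<partial>M)"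
    by (rule nn_integral_cong_AE, use lim in eventually_elim)
      (metis lim_imp_Liminf tendsto_ennrealI trivial_limit_sequentially)
  also have "\<dots> \<le> liminf (\<lambda>n. \<integral>\<^sup>+x. ennreal (f n x) \<partial>M)"
    using int by (intro nn_integral_liminf) auto
  also have "\<dots> \<le> liminf (\<lambda>n. ennreal B)"
    using int nn le by (intro Liminf_mono always_eventually) (auto simp: nn_integral_eq_integral intro!: ennreal_leI)
  finally have *: "(\<integral>\<^sup>+x. ennreal (F x) \<partial>M) \<le> ennreal B"
    by (simp add: Liminf_const)
  then show "integrable M F"
    using F F0 by (intro integrableI_nonneg) (auto simp: less_top[symmetric] top_unique)
  then show "integral\<^sup>L M F \<le> B"
    using * nn_integral_eq_integral[OF _ F0] B by simp
qed

section \<open>Density of continuous functions with compact support\<close>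

lemma L2_tendsto_dominated:
  assumes f: "\<And>n. f n \<in> borel_measurable lebesgue" and u: "u \<in> L2_space"
    and g: "integrable lebesgue g"
    and lim: "AE x in lebesgue. (\<lambda>n. f n x) \<longlonglongrightarrow> u x"
    and le: "\<And>n x. (cmod (f n x - u x))\<^sup>2 \<le> g x"
  shows "L2_tendsto f u"
proof -
  note [measurable] = L2_space_measurable[OF u] f
  have d: "(\<lambda>x. f n x - u x) \<in> L2_space" for n
    using g le by (intro L2_spaceI_bound[OF g]) auto
  have fn: "f n \<in> L2_space" for n
    using L2_space_add[OF d u, of n] by simp
  have "(\<lambda>n. LINT x|lebesgue. (cmod (f n x - u x))\<^sup>2) \<longlonglongrightarrow> (LINT x::'a|lebesgue. 0)"
  proof (rule integral_dominated_convergence[OF _ _ g])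
    show "AE x in lebesgue. (\<lambda>n. (cmod (f n x - u x))\<^sup>2) \<longlonglongrightarrow> 0"
      using lim
    proof eventually_elim
      case (elim x)
      then have "(\<lambda>n. (cmod (f n x - u x))\<^sup>2) \<longlonglongrightarrow> (cmod (u x - u x))\<^sup>2"
        by (intro tendsto_intros)
      then show ?case
        by simp
    qed
  qed (use le in auto)
  then have "(\<lambda>n. L2_norm (\<lambda>x. f n x - u x)) \<longlonglongrightarrow> sqrt 0"
    unfolding L2_norm_def by (intro tendsto_real_sqrt) simp
  then show ?thesis
    using fn u by (simp add: L2_tendsto_def)
qed

text \<open>
  A Lebesgue measurable function is almost everywhere a limit of continuous functions. If it is
  bounded with bounded support, these can be clipped in modulus and cut off outside a ball, after
  which dominated convergence turns the pointwise limit into one in the mean.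
\<close>

lemma bounded_support_approximation:
  assumes v: "v \<in> borel_measurable lebesgue" and R: "1 \<le> R"
    and b: "\<And>x. cmod (v x) \<le> R" and supp: "\<And>x. R < norm x \<Longrightarrow> v x = 0"
  shows "\<exists>w. L2_tendsto w v \<and> (\<forall>n. continuous_on UNIV (w n) \<and> (\<forall>x. R + 1 \<le> norm x \<longrightarrow> w n x = 0))"
proof -
  note [measurable] = v
  have "v measurable_on UNIV"
    by (intro lebesgue_measurable_imp_measurable_on v) auto
  then obtain N g where N: "negligible N" and g: "\<And>n. continuous_on UNIV (g n)"
    and lim: "\<And>x. x \<notin> N \<Longrightarrow> (\<lambda>n. g n x) \<longlonglongrightarrow> v x"
    by (auto simp: measurable_on_def)
  \<comment> \<open>\<open>\<rho>\<close> is the radial retraction onto the disc of radius \<open>R\<close>; \<open>\<kappa>\<close> is a continuous cutoff, equal to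
    1 on the ball of radius \<open>R\<close> and to 0 outside the ball of radius \<open>R + 1\<close>.\<close>
  define \<rho> where "\<rho> z = complex_of_real (R / max R (cmod z)) * z" for z
  define \<kappa> where "\<kappa> x = max 0 (1 - max 0 (norm x - R))" for x :: 'a
  define w where "w n x = complex_of_real (\<kappa> x) * \<rho> (g n x)" for n x
  have \<rho>_cont: "continuous_on UNIV \<rho>"
    unfolding \<rho>_def using R by (intro continuous_intros) (auto simp: max_def)
  have \<rho>_bound: "cmod (\<rho> z) \<le> R" for z
  proof -
    have "cmod (\<rho> z) = R / max R (cmod z) * cmod z"
      using R by (simp add: \<rho>_def norm_mult norm_divide)
    also have "\<dots> \<le> R"
      using R by (simp add: field_simps)
    finally show ?thesis .
  qed
  have \<rho>_id: "\<rho> z = z" if "cmod z \<le> R" for z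
    using that R by (simp add: \<rho>_def max_def)
  have \<kappa>: "0 \<le> \<kappa> x" "\<kappa> x \<le> 1" "R + 1 \<le> norm x \<Longrightarrow> \<kappa> x = 0" "norm x \<le> R \<Longrightarrow> \<kappa> x = 1" for x
    by (auto simp: \<kappa>_def)
  have w_cont: "continuous_on UNIV (w n)" for n
    unfolding w_def \<kappa>_def
    by (intro continuous_intros continuous_on_compose2[OF \<rho>_cont g]) auto
  have v_eq: "complex_of_real (\<kappa> x) * \<rho> (v x) = v x" for x
    using supp[of x] \<kappa>(4)[of x] b[of x] by (cases "norm x \<le> R") (auto simp: \<rho>_id)
  have ind: "integrable lebesgue (\<lambda>x::'a. (2 * R)\<^sup>2 * indicat_real (cball 0 (R + 1)) x)"
    by (intro integrable_mult_right integrable_real_indicator)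
      (auto intro: emeasure_bounded_finite[unfolded infinity_ennreal_def])
  have "L2_tendsto w v"
  proof (rule L2_tendsto_dominated[OF _ _ ind])
    show "w n \<in> borel_measurable lebesgue" for n
      using borel_measurable_continuous_onI[OF w_cont] by (intro measurable_completion) simp
    have vb: "(cmod (v x))\<^sup>2 \<le> (2 * R)\<^sup>2 * indicat_real (cball 0 (R + 1)) x" for x
    proof (cases "R < norm x")
      case True
      then show ?thesis
        using supp[of x] by simp
    next
      case False
      then show ?thesis
        using b[of x] R power_mono[of "cmod (v x)" "2 * R" 2] by simp
    qed
    show "v \<in> L2_space"
      by (rule L2_spaceI_bound[OF ind v vb])
    show "AE x in lebesgue. (\<lambda>n. w n x) \<longlonglongrightarrow> v x"
    proof (rule AE_I')
      show "N \<in> null_sets lebesgue"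
        using N by (simp add: negligible_iff_null_sets)
      have "(\<lambda>n. w n x) \<longlonglongrightarrow> v x" if "x \<notin> N" for x
      proof -
        have "isCont \<rho> (v x)"
          using \<rho>_cont by (simp add: continuous_on_eq_continuous_at)
        then have "(\<lambda>n. \<rho> (g n x)) \<longlonglongrightarrow> \<rho> (v x)"
          using lim[OF that] by (rule isCont_tendsto_compose)
        then have "(\<lambda>n. w n x) \<longlonglongrightarrow> complex_of_real (\<kappa> x) * \<rho> (v x)"
          unfolding w_def by (rule tendsto_mult_left)
        then show ?thesis
          by (simp add: v_eq)
      qed
      then show "{x \<in> space lebesgue. \<not> (\<lambda>n. w n x) \<longlonglongrightarrow> v x} \<subseteq> N"
        by auto
    qed
    show "(cmod (w n x - v x))\<^sup>2 \<le> (2 * R)\<^sup>2 * indicat_real (cball 0 (R + 1)) x" for n x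
    proof (cases "R + 1 < norm x")
      case True
      then show ?thesis
        using supp[of x] \<kappa>(3)[of x] by (simp add: w_def)
    next
      case False
      have "cmod (w n x) \<le> 1 * R"
        unfolding w_def norm_mult by (intro mult_mono) (use \<kappa> \<rho>_bound in auto)
      then have "cmod (w n x - v x) \<le> 2 * R"
        using b[of x] norm_triangle_ineq4[of "w n x" "v x"] by simp
      then show ?thesis
        using False power_mono[of "cmod (w n x - v x)" "2 * R" 2] by simp
    qed
  qed
  moreover have "w n x = 0" if "R + 1 \<le> norm x" for n x
    using \<kappa>(3)[OF that] by (simp add: w_def)
  ultimately show ?thesis
    using w_cont by blast
qed

lemma truncation_tendsto:
  assumes u: "u \<in> L2_space"
  shows "L2_tendsto (\<lambda>n x. if norm x \<le> real (Suc n) \<and> cmod (u x) \<le> real (Suc n) then u x else 0) u"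
    (is "L2_tendsto ?t u")
proof (rule L2_tendsto_dominated[where f="?t", OF _ u L2_space_integrable_square[OF u]])
  note [measurable] = L2_space_measurable[OF u]
  have [measurable]: "(\<lambda>x::'a. norm x) \<in> borel_measurable lebesgue"
    by (rule measurable_completion) simp
  show "?t n \<in> borel_measurable lebesgue" for n
    by measurable
  show "AE x in lebesgue. (\<lambda>n. ?t n x) \<longlonglongrightarrow> u x"
  proof (rule AE_I2, rule tendsto_eventually)
    fix x :: 'a
    obtain m where m: "max (norm x) (cmod (u x)) < real m"
      using reals_Archimedean2 by blast
    show "\<forall>\<^sub>F n in sequentially. ?t n x = u x"
      using eventually_ge_at_top[of m] by eventually_elim (use m in auto)
  qed
qed simp

text \<open>
  Continuous functions with compact support, the support condition being vanishing outside some ball.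
\<close>

definition cc_function :: "('a::euclidean_space \<Rightarrow> complex) \<Rightarrow> bool" where
  "cc_function f \<longleftrightarrow> continuous_on UNIV f \<and> (\<exists>R. \<forall>x. R \<le> norm x \<longrightarrow> f x = 0)"

lemma cc_function_dense:
  assumes u: "u \<in> L2_space"
  shows "\<exists>f. L2_tendsto f u \<and> (\<forall>n. cc_function (f n))"
proof -
  have "\<exists>f. f \<in> L2_space \<and> L2_norm (\<lambda>x. f x - u x) \<le> inverse (real (Suc n)) \<and> cc_function f" for n
  proof -
    define v where "v m x = (if norm x \<le> real (Suc m) \<and> cmod (u x) \<le> real (Suc m) then u x else 0)" for m x
    have v: "L2_tendsto v u"
      using truncation_tendsto[OF u] by (simp add: v_def[abs_def])
    then have "\<forall>\<^sub>F m in sequentially. L2_norm (\<lambda>x. v m x - u x) < inverse (real (Suc n)) / 2"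
      by (intro order_tendstoD(2)[where y=0]) (auto simp: L2_tendsto_def)
    then obtain m where m: "L2_norm (\<lambda>x. v m x - u x) < inverse (real (Suc n)) / 2"
      using eventually_happens'[OF sequentially_bot] by blast
    have vm: "v m \<in> L2_space"
      using v by (simp add: L2_tendsto_def)
    obtain w where w: "L2_tendsto w (v m)" "\<And>n. cc_function (w n)"
    proof -
      have "cmod (v m x) \<le> real (Suc m)" "real (Suc m) < norm x \<Longrightarrow> v m x = 0" for x
        by (auto simp: v_def)
      from bounded_support_approximation[OF L2_space_measurable[OF vm] _ this]
      obtain w where "L2_tendsto w (v m)"
        and "\<And>n. continuous_on UNIV (w n)" "\<And>n x. real (Suc m) + 1 \<le> norm x \<Longrightarrow> w n x = 0"
        by auto
      then show ?thesis
        by (intro that[of w]) (auto simp: cc_function_def)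
    qed
    then have "\<forall>\<^sub>F k in sequentially. L2_norm (\<lambda>x. w k x - v m x) < inverse (real (Suc n)) / 2"
      by (intro order_tendstoD(2)[where y=0]) (auto simp: L2_tendsto_def)
    then obtain k where k: "L2_norm (\<lambda>x. w k x - v m x) < inverse (real (Suc n)) / 2"
      using eventually_happens'[OF sequentially_bot] by blast
    have wk: "w k \<in> L2_space"
      using w by (simp add: L2_tendsto_def)
    show ?thesis
      using L2_dist_triangle[OF wk vm u] wk w(2) k m by (intro exI[of _ "w k"]) auto
  qed
  then obtain f where f: "\<And>n. f n \<in> L2_space" "\<And>n. cc_function (f n)"
    "\<And>n. L2_norm (\<lambda>x. f n x - u x) \<le> inverse (real (Suc n))"
    by metis
  have "(\<lambda>n. L2_norm (\<lambda>x. f n x - u x)) \<longlonglongrightarrow> 0"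
    by (rule tendsto_sandwich[OF _ _ tendsto_const LIMSEQ_inverse_real_of_nat])
      (use f(3) in auto)
  then show ?thesis
    using f u unfolding L2_tendsto_def by blast
qed

lemma cc_function_measurable: "cc_function f \<Longrightarrow> f \<in> borel_measurable borel"
  by (simp add: cc_function_def borel_measurable_continuous_onI)

lemma cc_function_bounded:
  assumes "cc_function f"
  shows "\<exists>B. \<forall>x. cmod (f x) \<le> B"
proof -
  obtain R where R: "\<And>x. R \<le> norm x \<Longrightarrow> f x = 0" and f: "continuous_on UNIV f"
    using assms by (auto simp: cc_function_def)
  have "compact (f ` cball 0 R)"
    by (intro compact_continuous_image continuous_on_subset[OF f]) auto
  then obtain B where B: "\<And>x. x \<in> cball 0 R \<Longrightarrow> cmod (f x) \<le> B"
    by (metis bounded_iff compact_imp_bounded imageI)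
  have "cmod (f x) \<le> max B 0" for x
    using B[of x] R[of x] by (cases "norm x \<le> R") auto
  then show ?thesis
    by blast
qed

lemma cc_function_integrable:
  assumes "cc_function f"
  shows "integrable lebesgue f" "f \<in> L2_space"
proof -
  obtain R where R: "\<And>x. R \<le> norm x \<Longrightarrow> f x = 0"
    using assms by (auto simp: cc_function_def)
  obtain B where B: "\<And>x. cmod (f x) \<le> B"
    using cc_function_bounded[OF assms] by blast
  have meas: "f \<in> borel_measurable lebesgue"
    using cc_function_measurable[OF assms] by (intro measurable_completion) simp
  have ind: "integrable lebesgue (\<lambda>x::'a. c * indicat_real (cball 0 R) x)" for c
    by (intro integrable_mult_right integrable_real_indicator)
      (auto intro: emeasure_bounded_finite[unfolded infinity_ennreal_def])
  have B0: "0 \<le> B"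
    using B[of 0] norm_ge_zero order_trans by blast
  have "cmod (f x) \<le> B * indicat_real (cball 0 R) x" for x
    using B[of x] R[of x] by (auto simp: indicator_def)
  then show "integrable lebesgue f"
    using B0 by (intro Bochner_Integration.integrable_bound[OF ind[of B] meas]) (auto simp: abs_mult)
  have "(cmod (f x))\<^sup>2 \<le> B\<^sup>2 * indicat_real (cball 0 R) x" for x
    using B[of x] R[of x] by (auto simp: indicator_def intro: power_mono)
  then show "f \<in> L2_space"
    by (rule L2_spaceI_bound[OF ind meas])
qed

section \<open>Completeness\<close>

text \<open>
  The theorem of Riesz and Fischer. Along a subsequence with increments \<open>h j\<close> of norm below \<open>2\<^sup>-\<^sup>j\<close>, the
  sum of \<open>2\<^sup>j (h j)\<^sup>2\<close> has finite integral and is therefore finite almost everywhere. There \<open>h j\<close> is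
  bounded by a multiple of \<open>2\<^bsup>-j/2\<^esup>\<close>, so that the subsequence converges pointwise. By Fatou's
  lemma the pointwise limit is also the limit in the mean of the full sequence.
\<close>

lemma L2_complete:
  assumes f: "\<And>n. f n \<in> L2_space"
    and Cauchy: "\<And>e. 0 < e \<Longrightarrow> \<exists>K. \<forall>m\<ge>K. \<forall>n\<ge>K. L2_norm (\<lambda>x. f m x - f n x) < e"
  shows "\<exists>g. L2_tendsto f g"
proof -
  note [measurable] = L2_space_measurable[OF f]
  have "\<exists>K. \<forall>m\<ge>K. \<forall>n\<ge>K. L2_norm (\<lambda>x. f m x - f n x) < (1/2)^j" for j
    by (rule Cauchy) simp
  then obtain K where K: "\<And>j m n. K j \<le> m \<Longrightarrow> K j \<le> n \<Longrightarrow> L2_norm (\<lambda>x. f m x - f n x) < (1/2)^j"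
    by metis
  \<comment> \<open>A sum rather than \<open>K j\<close> itself, so that \<open>K i \<le> r j\<close> for all \<open>i \<le> j\<close>.\<close>
  define r where "r j = (\<Sum>i\<le>j. K i)" for j
  have r: "K i \<le> r j" if "i \<le> j" for i j
    unfolding r_def using that by (intro member_le_sum) auto
  define h where "h j x = cmod (f (r (Suc j)) x - f (r j) x)" for j x
  have h_int: "integrable lebesgue (\<lambda>x. (h j x)\<^sup>2)" for j
    using L2_space_integrable_square[OF L2_space_diff[OF f f]] by (simp add: h_def)
  have h_le: "(LINT x|lebesgue. (h j x)\<^sup>2) \<le> (1/4)^j" for j
  proof -
    have "L2_norm (\<lambda>x. f (r (Suc j)) x - f (r j) x) \<le> (1/2)^j"
      by (intro less_imp_le[OF K[of j]] r) auto
    then have "(L2_norm (\<lambda>x. f (r (Suc j)) x - f (r j) x))\<^sup>2 \<le> ((1/2)^j)\<^sup>2"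
      by (intro power_mono) auto
    moreover have "((1/2)^j)\<^sup>2 = ((1/4)^j :: real)"
      by (simp add: power2_eq_square flip: power_mult_distrib)
    ultimately show ?thesis
      by (simp add: L2_norm_power2 h_def)
  qed
  have [measurable]: "h j \<in> borel_measurable lebesgue" for j
    unfolding h_def by measurable
  have "(\<integral>\<^sup>+x. (\<Sum>j. ennreal (2^j * (h j x)\<^sup>2)) \<partial>lebesgue) = (\<Sum>j. \<integral>\<^sup>+x. ennreal (2^j * (h j x)\<^sup>2) \<partial>lebesgue)"
    by (rule nn_integral_suminf) measurable
  also have "\<dots> \<le> (\<Sum>j. ennreal ((1/2)^j))"
  proof (intro suminf_le summableI)
    fix j
    have "(\<integral>\<^sup>+x. ennreal (2^j * (h j x)\<^sup>2) \<partial>lebesgue) = ennreal (2^j * (LINT x|lebesgue. (h j x)\<^sup>2))"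
      using h_int[of j] by (subst nn_integral_eq_integral) auto
    also have "\<dots> \<le> ennreal (2^j * (1/4)^j)"
      using h_le[of j] by (intro ennreal_leI mult_left_mono) auto
    also have "2^j * (1/4)^j = ((1/2)^j :: real)"
      by (simp flip: power_mult_distrib)
    finally show "(\<integral>\<^sup>+x. ennreal (2^j * (h j x)\<^sup>2) \<partial>lebesgue) \<le> ennreal ((1/2)^j)" .
  qed
  also have "\<dots> = ennreal (\<Sum>j. (1/2)^j)"
    by (intro suminf_ennreal2) (auto intro: summable_geometric)
  finally have "(\<integral>\<^sup>+x. (\<Sum>j. ennreal (2^j * (h j x)\<^sup>2)) \<partial>lebesgue) \<noteq> \<infinity>"
    by (auto simp: top_unique)
  then have "AE x in lebesgue. (\<Sum>j. ennreal (2^j * (h j x)\<^sup>2)) \<noteq> \<infinity>"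
    by (intro nn_integral_PInf_AE) auto
  then have conv: "AE x in lebesgue. convergent (\<lambda>j. f (r j) x)"
  proof eventually_elim
    case (elim x)
    then have "summable (\<lambda>j. 2^j * (h j x)\<^sup>2)"
      by (intro summable_suminf_not_top) auto
    then have "Bseq (\<lambda>j. 2^j * (h j x)\<^sup>2)"
      by (intro convergent_imp_Bseq) (auto simp: convergent_def dest: summable_LIMSEQ_zero)
    then obtain C where C: "\<And>j. 2^j * (h j x)\<^sup>2 \<le> C"
      by (auto simp: Bseq_def)
    have "norm (h j x) \<le> sqrt C * (1 / sqrt 2)^j" for j
    proof -
      have "(h j x)\<^sup>2 \<le> C * (1/2)^j"
        using C[of j] by (simp add: field_simps)
      then have "sqrt ((h j x)\<^sup>2) \<le> sqrt (C * (1/2)^j)"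
        by (rule real_sqrt_le_mono)
      moreover have "sqrt ((h j x)\<^sup>2) = norm (h j x)"
        by simp
      moreover have "sqrt (C * (1/2)^j) = sqrt C * (1 / sqrt 2)^j"
        by (simp add: real_sqrt_mult real_sqrt_power real_sqrt_divide)
      ultimately show ?thesis
        by simp
    qed
    moreover have "summable (\<lambda>j. sqrt C * (1 / sqrt 2)^j)"
      by (intro summable_mult summable_geometric) simp
    ultimately have "summable (\<lambda>j. h j x)"
      by (blast intro: summable_comparison_test')
    then have "summable (\<lambda>j. f (r (Suc j)) x - f (r j) x)"
      unfolding h_def by (rule summable_norm_cancel)
    then have "convergent (\<lambda>n. \<Sum>j<n. f (r (Suc j)) x - f (r j) x)"
      by (simp add: summable_iff_convergent)
    then have "convergent (\<lambda>n. (f (r n) x - f (r 0) x) + f (r 0) x)"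
      unfolding sum_lessThan_telescope[of "\<lambda>j. f (r j) x"] by (intro convergent_add convergent_const)
    then show ?case
      by simp
  qed
  define g where "g x = lim (\<lambda>j. f (r j) x)" for x
  have g_meas [measurable]: "g \<in> borel_measurable lebesgue"
    unfolding g_def by (rule borel_measurable_lim_metric) simp
  have g_lim: "AE x in lebesgue. (\<lambda>j. f (r j) x) \<longlonglongrightarrow> g x"
    using conv by eventually_elim (simp add: g_def convergent_LIMSEQ_iff)
  have close: "integrable lebesgue (\<lambda>x. (cmod (f n x - g x))\<^sup>2) \<and>
      (LINT x|lebesgue. (cmod (f n x - g x))\<^sup>2) \<le> ((1/2)^i)\<^sup>2" if "K i \<le> n" for i n
  proof -
    have int: "integrable lebesgue (\<lambda>x. (cmod (f n x - f (r (j + i)) x))\<^sup>2)" for j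
      by (rule L2_space_integrable_square[OF L2_space_diff[OF f f]])
    have le: "(LINT x|lebesgue. (cmod (f n x - f (r (j + i)) x))\<^sup>2) \<le> ((1/2)^i)\<^sup>2" for j
      unfolding L2_norm_power2[symmetric]
      by (intro power_mono less_imp_le[OF K[of i]] that r) auto
    have "AE x in lebesgue. (\<lambda>j. (cmod (f n x - f (r (j + i)) x))\<^sup>2) \<longlonglongrightarrow> (cmod (f n x - g x))\<^sup>2"
      using g_lim by eventually_elim (intro tendsto_intros LIMSEQ_ignore_initial_segment)
    from integrable_Fatou[OF int _ le _ this] show ?thesis
      by simp
  qed
  have "(\<lambda>x. f (K 0) x - g x) \<in> L2_space"
    using close[of 0 "K 0"] by (simp add: L2_space_def)
  from L2_space_diff[OF f[of "K 0"] this] have g_L2: "g \<in> L2_space"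
    by simp
  moreover have "(\<lambda>n. L2_norm (\<lambda>x. f n x - g x)) \<longlonglongrightarrow> 0"
  proof (rule LIMSEQ_I)
    fix e :: real
    assume "0 < e"
    then obtain i where i: "(1/2)^i < e"
      using real_arch_pow_inv[of e "1/2"] by auto
    have "norm (L2_norm (\<lambda>x. f n x - g x) - 0) < e" if "K i \<le> n" for n
    proof -
      have "L2_norm (\<lambda>x. f n x - g x) \<le> (1/2)^i"
        by (rule power2_le_imp_le) (use close[OF that] in \<open>auto simp: L2_norm_power2\<close>)
      then show ?thesis
        using i by simp
    qed
    then show "\<exists>no. \<forall>n\<ge>no. norm (L2_norm (\<lambda>x. f n x - g x) - 0) < e"
      by blast
  qed
  ultimately show ?thesis
    using f by (auto simp: L2_tendsto_def)
qed

section \<open>Gaussians and their Fourier transform\<close>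

lemma lborel_integral_prod_Basis:
  fixes f :: "'a::euclidean_space \<Rightarrow> real \<Rightarrow> complex"
  assumes f: "\<And>b. b \<in> Basis \<Longrightarrow> integrable lborel (f b)"
  shows "integrable lborel (\<lambda>x::'a. \<Prod>b\<in>Basis. f b (x \<bullet> b))"
    and "(LINT x::'a|lborel. (\<Prod>b\<in>Basis. f b (x \<bullet> b))) = (\<Prod>b\<in>Basis. (LINT t|lborel. f b t))"
proof -
  interpret product_sigma_finite "\<lambda>_::'a. lborel :: real measure"
    by standard
  have [measurable]: "f b \<in> borel_measurable borel" if "b \<in> Basis" for b
    using f[OF that] by (simp add: integrable_iff_bounded)
  have T: "(\<lambda>y. \<Sum>b\<in>Basis. y b *\<^sub>R b) \<in> (\<Pi>\<^sub>M b\<in>Basis. lborel :: real measure) \<rightarrow>\<^sub>M (borel :: 'a measure)"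
    by measurable
  have F: "(\<lambda>x::'a. \<Prod>b\<in>Basis. f b (x \<bullet> b)) \<in> borel_measurable borel"
    by measurable
  have eq: "(\<Prod>b\<in>Basis. f b ((\<Sum>b\<in>Basis. y b *\<^sub>R b) \<bullet> b)) = (\<Prod>b\<in>Basis. f b (y b))" for y
    by (intro prod.cong) auto
  show "integrable lborel (\<lambda>x::'a. \<Prod>b\<in>Basis. f b (x \<bullet> b))"
    by (subst lborel_eq, subst integrable_distr_eq[OF T F], unfold eq)
      (intro product_integrable_prod f finite_Basis)
  show "(LINT x::'a|lborel. (\<Prod>b\<in>Basis. f b (x \<bullet> b))) = (\<Prod>b\<in>Basis. (LINT t|lborel. f b t))"
    by (subst lborel_eq, subst integral_distr[OF T F], unfold eq)
      (intro product_integral_prod f finite_Basis)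
qed

lemma integrable_scaleR_iff:
  fixes f :: "'a \<Rightarrow> 'b::{banach, second_countable_topology}"
  assumes "k \<noteq> 0"
  shows "integrable M (\<lambda>x. k *\<^sub>R f x) \<longleftrightarrow> integrable M f"
proof
  assume "integrable M (\<lambda>x. k *\<^sub>R f x)"
  then have "integrable M (\<lambda>x. inverse k *\<^sub>R (k *\<^sub>R f x))"
    by (rule integrable_scaleR_right)
  then show "integrable M f"
    using assms by simp
qed simp

text \<open>
  The one-dimensional case is the characteristic function of the standard normal distribution, after
  the substitution \<open>t \<mapsto> sqrt (2 * pi) * t\<close>.
\<close>

lemma fourier_gauss_real:
  shows "integrable lborel (\<lambda>t. cis (2 * pi * (z * t)) * of_real (exp (- pi * t\<^sup>2)))"
    and "(LINT t|lborel. cis (2 * pi * (z * t)) * of_real (exp (- pi * t\<^sup>2))) = of_real (exp (- pi * z\<^sup>2))"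
proof -
  define c where "c = sqrt (2 * pi)"
  have c: "c > 0" "c * c = 2 * pi"
    by (simp_all add: c_def)
  define f where "f t = std_normal_density t *\<^sub>R cis (c * z * t)" for t
  have f_affine: "f (0 + c * t) = (1 / c) *\<^sub>R (cis (2 * pi * (z * t)) * of_real (exp (- pi * t\<^sup>2)))" for t
  proof -
    have 1: "std_normal_density (0 + c * t) = 1 / c * exp (- pi * t\<^sup>2)"
      using c by (simp add: std_normal_density_def c_def power_mult_distrib)
    have "c * z * (0 + c * t) = (c * c) * (z * t)"
      by simp
    then have 2: "c * z * (0 + c * t) = 2 * pi * (z * t)"
      by (simp only: c(2))
    show ?thesis
      by (simp only: f_def 1 2) (simp add: scaleR_conv_of_real)
  qed
  have f_int: "integrable lborel f"
  proof (rule Bochner_Integration.integrable_bound)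
    show "integrable lborel std_normal_density"
      using integrable_std_normal_moment[of 0] by simp
    show "f \<in> borel_measurable lborel"
      unfolding f_def cis_conv_exp by measurable
  qed (simp add: f_def)
  have "(LINT t|lborel. f t) = char std_normal_distribution (c * z)"
    unfolding char_def f_def
    by (subst integral_density) (auto simp: cis_conv_exp)
  then have f_lint: "(LINT t|lborel. f t) = of_real (exp (- pi * z\<^sup>2))"
    using c by (simp add: char_std_normal_distribution power_mult_distrib power2_eq_square[of c])
  have "integrable lborel (\<lambda>t. f (0 + c * t))"
    using f_int c by (intro lborel_integrable_real_affine) auto
  then show "integrable lborel (\<lambda>t. cis (2 * pi * (z * t)) * of_real (exp (- pi * t\<^sup>2)))"
    unfolding f_affine using c by (simp add: integrable_scaleR_iff)
  have "(LINT t|lborel. f t) = c *\<^sub>R (LINT t|lborel. f (0 + c * t))"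
    using lborel_integral_real_affine[of c f 0] c by simp
  then show "(LINT t|lborel. cis (2 * pi * (z * t)) * of_real (exp (- pi * t\<^sup>2))) = of_real (exp (- pi * z\<^sup>2))"
    unfolding f_lint f_affine using c by simp
qed

text \<open>
  The Gaussian normalised so as to be its own Fourier transform; in particular its integral is 1.
\<close>

definition gauss :: "'a::euclidean_space \<Rightarrow> real" where
  "gauss x = exp (- pi * (norm x)\<^sup>2)"

lemma gauss_nonneg [simp]: "0 \<le> gauss x"
  and gauss_le_1: "gauss x \<le> 1" and gauss_minus [simp]: "gauss (- x) = gauss x"
  by (simp_all add: gauss_def)

lemma continuous_on_gauss [continuous_intros]:
  "continuous_on S f \<Longrightarrow> continuous_on S (\<lambda>x. gauss (f x))"
  unfolding gauss_def by (intro continuous_intros)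

lemma borel_measurable_gauss [measurable]: "gauss \<in> borel_measurable borel"
  by (intro borel_measurable_continuous_onI continuous_intros)

lemma borel_measurable_cis [measurable]: "cis \<in> borel_measurable borel"
  by (intro borel_measurable_continuous_onI continuous_intros)

lemma borel_imp_lebesgue_measurable: "f \<in> borel_measurable borel \<Longrightarrow> f \<in> borel_measurable lebesgue"
  by (intro measurable_completion) simp

lemma fourier_gauss_lborel:
  fixes z :: "'a::euclidean_space"
  shows "integrable lborel (\<lambda>x. cis (2 * pi * (z \<bullet> x)) * of_real (gauss x))"
    and "(LINT x|lborel. cis (2 * pi * (z \<bullet> x)) * of_real (gauss x)) = of_real (gauss z)"
proof -
  have cis_sum: "cis (\<Sum>b\<in>B. g b) = (\<Prod>b\<in>B. cis (g b))" if "finite B" for B :: "'a set" and g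
    using that by induction (auto simp: cis_mult[symmetric])
  have sq: "(norm x)\<^sup>2 = (\<Sum>b\<in>Basis. (x \<bullet> b)\<^sup>2)" for x :: 'a
    unfolding power2_norm_eq_inner by (subst euclidean_inner) (simp add: power2_eq_square)
  have gauss_prod: "gauss x = (\<Prod>b\<in>Basis. exp (- pi * (x \<bullet> b)\<^sup>2))" for x :: 'a
    unfolding gauss_def sq sum_distrib_left by (rule exp_sum) simp
  have prod: "cis (2 * pi * (z \<bullet> x)) * of_real (gauss x) =
      (\<Prod>b\<in>Basis. cis (2 * pi * ((z \<bullet> b) * (x \<bullet> b))) * of_real (exp (- pi * (x \<bullet> b)\<^sup>2)))" for x
    unfolding gauss_prod euclidean_inner[of z x] sum_distrib_left
    by (simp add: cis_sum prod.distrib)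
  show "integrable lborel (\<lambda>x. cis (2 * pi * (z \<bullet> x)) * of_real (gauss x))"
    unfolding prod
    by (rule lborel_integral_prod_Basis[where
          f="\<lambda>b t. cis (2 * pi * ((z \<bullet> b) * t)) * of_real (exp (- pi * t\<^sup>2))"])
      (rule fourier_gauss_real)
  show "(LINT x|lborel. cis (2 * pi * (z \<bullet> x)) * of_real (gauss x)) = of_real (gauss z)"
    unfolding prod
    by (subst lborel_integral_prod_Basis[where
          f="\<lambda>b t. cis (2 * pi * ((z \<bullet> b) * t)) * of_real (exp (- pi * t\<^sup>2))"])
      (simp_all only: fourier_gauss_real gauss_prod of_real_prod)
qed

lemma lebesgue_integral_affine:
  fixes f :: "'a::euclidean_space \<Rightarrow> 'b::{banach, second_countable_topology}"
  assumes f: "f \<in> borel_measurable borel" and c: "c \<noteq> 0"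
  shows "integrable lebesgue (\<lambda>x. f (t + c *\<^sub>R x)) \<longleftrightarrow> integrable lebesgue f"
    and "(LINT x|lebesgue. f (t + c *\<^sub>R x)) = (1 / \<bar>c\<bar> ^ DIM('a)) *\<^sub>R (LINT x|lebesgue. f x)"
proof -
  note [measurable] = f
  have "integrable lborel f \<longleftrightarrow>
      integrable (density (distr lborel borel (\<lambda>x. t + c *\<^sub>R x)) (\<lambda>_. \<bar>c\<bar> ^ DIM('a))) f"
    using lborel_affine[OF c, of t] by simp
  also have "\<dots> \<longleftrightarrow> integrable lborel (\<lambda>x. f (t + c *\<^sub>R x))"
    using c by (subst integrable_density) (auto simp: integrable_distr_eq integrable_scaleR_iff)
  finally show "integrable lebesgue (\<lambda>x. f (t + c *\<^sub>R x)) \<longleftrightarrow> integrable lebesgue f"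
    by (simp add: integrable_completion)
  have "(LINT x|lborel. f x) =
      (LINT x|density (distr lborel borel (\<lambda>x. t + c *\<^sub>R x)) (\<lambda>_. \<bar>c\<bar> ^ DIM('a)). f x)"
    using lborel_affine[OF c, of t] by simp
  also have "\<dots> = \<bar>c\<bar> ^ DIM('a) *\<^sub>R (LINT x|lborel. f (t + c *\<^sub>R x))"
    using c by (subst integral_density) (auto simp: integral_distr)
  finally show "(LINT x|lebesgue. f (t + c *\<^sub>R x)) = (1 / \<bar>c\<bar> ^ DIM('a)) *\<^sub>R (LINT x|lebesgue. f x)"
    using c by (simp add: integral_completion)
qed

lemma gauss_integrable: "integrable lebesgue (gauss :: 'a::euclidean_space \<Rightarrow> real)"
  and gauss_integral: "(LINT x::'a|lebesgue. gauss x) = 1"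
proof -
  have i: "integrable lborel (\<lambda>x::'a. complex_of_real (gauss x))"
    and e: "(LINT x::'a|lborel. complex_of_real (gauss x)) = 1"
    using fourier_gauss_lborel[of "0::'a"] by (simp_all add: gauss_def)
  have "integrable lborel (gauss :: 'a \<Rightarrow> real)"
    using i by (simp add: complex_of_real_integrable_eq)
  then show "integrable lebesgue (gauss :: 'a \<Rightarrow> real)"
    by (simp add: integrable_completion)
  have "(LINT x::'a|lborel. gauss x) = 1"
    using e by (metis integral_complex_of_real of_real_eq_1_iff)
  then show "(LINT x::'a|lebesgue. gauss x) = 1"
    by (simp add: integral_completion)
qed

lemma gauss_scaled_integrable:
  "c \<noteq> 0 \<Longrightarrow> integrable lebesgue (\<lambda>x::'a::euclidean_space. gauss (t + c *\<^sub>R x))"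
  and gauss_scaled_integral:
  "c \<noteq> 0 \<Longrightarrow> (LINT x::'a|lebesgue. gauss (t + c *\<^sub>R x)) = 1 / \<bar>c\<bar> ^ DIM('a)"
  by (simp_all add: lebesgue_integral_affine[where f=gauss] gauss_integrable gauss_integral)

lemma fourier_gauss_scaled:
  fixes z :: "'a::euclidean_space"
  assumes c: "0 < c"
  shows "(LINT x|lebesgue. cis (2 * pi * (z \<bullet> x)) * of_real (gauss (c *\<^sub>R x))) =
    of_real (gauss ((1 / c) *\<^sub>R z) / c ^ DIM('a))"
proof -
  define f where "f x = cis (2 * pi * (((1 / c) *\<^sub>R z) \<bullet> x)) * of_real (gauss x)" for x :: 'a
  have f: "f \<in> borel_measurable borel"
    unfolding f_def by measurable
  have "(LINT x|lebesgue. f (0 + c *\<^sub>R x)) = (1 / \<bar>c\<bar> ^ DIM('a)) *\<^sub>R (LINT x|lebesgue. f x)"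
    using c by (intro lebesgue_integral_affine f) simp
  also have "(LINT x|lebesgue. f x) = (LINT x|lborel. f x)"
    using f by (simp add: integral_completion)
  also have "\<dots> = of_real (gauss ((1 / c) *\<^sub>R z))"
    unfolding f_def by (rule fourier_gauss_lborel)
  finally show ?thesis
    using c by (simp add: f_def scaleR_conv_of_real field_simps)
qed

lemma gauss_damping_tendsto:
  assumes "c \<longlonglongrightarrow> 0"
  shows "(\<lambda>n. gauss (c n *\<^sub>R \<xi>) * a) \<longlonglongrightarrow> a"
proof -
  have "(\<lambda>n. gauss (c n *\<^sub>R \<xi>) * a) \<longlonglongrightarrow> exp (- pi * (norm (0 *\<^sub>R \<xi>))\<^sup>2) * a"
    unfolding gauss_def using assms by (intro tendsto_intros)
  then show ?thesis
    by simp
qed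

section \<open>Products of Lebesgue measure\<close>

lemma sigma_finite_lebesgue: "sigma_finite_measure (lebesgue :: 'a::euclidean_space measure)"
proof
  obtain A :: "'a set set" where A: "countable A" "A \<subseteq> sets lborel" "\<Union>A = space lborel"
    "\<forall>a\<in>A. emeasure lborel a \<noteq> \<infinity>"
    using lborel.sigma_finite_countable by blast
  then show "\<exists>A. countable A \<and> A \<subseteq> sets (lebesgue :: 'a measure) \<and> \<Union>A = space lebesgue \<and>
      (\<forall>a\<in>A. emeasure lebesgue a \<noteq> \<infinity>)"
    by (intro exI[of _ A]) auto
qed

lemma pair_sigma_finite_lebesgue:
  "pair_sigma_finite (lebesgue :: 'a::euclidean_space measure) (lebesgue :: 'b::euclidean_space measure)"
  by (simp add: pair_sigma_finite_def sigma_finite_lebesgue)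

lemma measurable_lebesgue_imp_borel: "f \<in> M \<rightarrow>\<^sub>M lebesgue \<Longrightarrow> f \<in> borel_measurable M"
  by (rule measurable_compose[OF _ borel_imp_lebesgue_measurable]) auto

lemma (in pair_sigma_finite) integrable_tensor:
  fixes f :: "'a \<Rightarrow> 'c::{real_normed_field, banach, second_countable_topology}"
  assumes f: "integrable M1 f" and g: "integrable M2 g"
  shows "integrable (M1 \<Otimes>\<^sub>M M2) (\<lambda>p. f (fst p) * g (snd p))"
    and "(LINT p|(M1 \<Otimes>\<^sub>M M2). f (fst p) * g (snd p)) = integral\<^sup>L M1 f * integral\<^sup>L M2 g"
proof -
  have [measurable]: "f \<in> borel_measurable M1" "g \<in> borel_measurable M2"
    using f g by auto
  show int: "integrable (M1 \<Otimes>\<^sub>M M2) (\<lambda>p. f (fst p) * g (snd p))"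
  proof (rule Fubini_integrable)
    show "integrable M1 (\<lambda>x. LINT y|M2. norm (f (fst (x, y)) * g (snd (x, y))))"
      using f by (simp add: norm_mult)
    show "AE x in M1. integrable M2 (\<lambda>y. f (fst (x, y)) * g (snd (x, y)))"
      using g by simp
  qed simp
  show "(LINT p|(M1 \<Otimes>\<^sub>M M2). f (fst p) * g (snd p)) = integral\<^sup>L M1 f * integral\<^sup>L M2 g"
    using integral_fst'[OF int] by simp
qed

section \<open>The Fourier integral of integrable functions\<close>

text \<open>
  The Fourier integral with the sign of the exponent as a parameter: \<open>\<sigma> = - 1\<close> gives
  \<open>fourier_integral\<close>, and \<open>\<sigma> = 1\<close> gives \<open>inv_fourier_integral\<close>.
\<close>

definition osc_integral :: "real \<Rightarrow> ('a::euclidean_space \<Rightarrow> complex) \<Rightarrow> 'a \<Rightarrow> complex" where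
  "osc_integral \<sigma> u \<xi> = (LINT x|lebesgue. cis (2 * pi * (\<sigma> * (\<xi> \<bullet> x))) * u x)"

lemma osc_integrand_measurable:
  assumes "u \<in> borel_measurable lebesgue"
  shows "(\<lambda>x. cis (2 * pi * (\<sigma> * (\<xi> \<bullet> x))) * u x) \<in> borel_measurable lebesgue"
proof -
  have "(\<lambda>x. cis (2 * pi * (\<sigma> * (\<xi> \<bullet> x)))) \<in> borel_measurable lebesgue"
    by (intro borel_imp_lebesgue_measurable) measurable
  then show ?thesis
    using assms by simp
qed

lemma osc_integrand_integrable:
  assumes "integrable lebesgue u"
  shows "integrable lebesgue (\<lambda>x. cis (2 * pi * (\<sigma> * (\<xi> \<bullet> x))) * u x)"
  using assms osc_integrand_measurable[of u \<sigma> \<xi>]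
  by (intro Bochner_Integration.integrable_bound[OF assms]) (auto simp: norm_mult)

lemma osc_integral_measurable:
  fixes u :: "'a::euclidean_space \<Rightarrow> complex"
  assumes u: "u \<in> borel_measurable lebesgue"
  shows "osc_integral \<sigma> u \<in> borel_measurable lebesgue"
proof -
  interpret sigma_finite_measure "lebesgue :: 'a measure"
    by (rule sigma_finite_lebesgue)
  note [measurable] = u
  have [measurable]: "fst \<in> borel_measurable ((borel :: 'a measure) \<Otimes>\<^sub>M (lebesgue :: 'a measure))"
    by measurable
  have [measurable]: "snd \<in> borel_measurable ((borel :: 'a measure) \<Otimes>\<^sub>M (lebesgue :: 'a measure))"
    by (intro measurable_lebesgue_imp_borel) measurable
  have "osc_integral \<sigma> u \<in> borel_measurable borel"
    unfolding osc_integral_def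
  proof (rule borel_measurable_lebesgue_integral)
    show "(\<lambda>(\<xi>, x). cis (2 * pi * (\<sigma> * (\<xi> \<bullet> x))) * u x) \<in> borel_measurable (borel \<Otimes>\<^sub>M lebesgue)"
      unfolding case_prod_beta by measurable
  qed
  then show ?thesis
    by (rule borel_imp_lebesgue_measurable)
qed

text \<open>
  Damping \<open>\<bar>\<F> u\<bar>\<^sup>2\<close> by a Gaussian makes the triple integral over \<open>\<xi>\<close>, \<open>x\<close>, \<open>y\<close> of
  \<open>gauss (c\<xi>) * cis (2\<pi>\<sigma> \<xi> \<bullet> (x - y)) * u(x) * cnj (u(y))\<close> absolutely convergent. Evaluating the
  \<open>\<xi>\<close>-integral first yields the Gaussian kernel on the right-hand side, which is an approximate
  identity as \<open>c\<close> tends to 0.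
\<close>

lemma gauss_weighted_plancherel:
  fixes u :: "'a::euclidean_space \<Rightarrow> complex"
  assumes u: "integrable lebesgue u" and c: "0 < c" and \<sigma>: "\<bar>\<sigma>\<bar> = 1"
  shows "integrable lebesgue (\<lambda>\<xi>. gauss (c *\<^sub>R \<xi>) * (cmod (osc_integral \<sigma> u \<xi>))\<^sup>2)" (is ?A)
    and "integrable (lebesgue \<Otimes>\<^sub>M lebesgue)
      (\<lambda>p. u (fst p) * cnj (u (snd p)) * of_real (gauss ((1 / c) *\<^sub>R (fst p - snd p)) / c ^ DIM('a)))" (is ?B)
    and "complex_of_real (LINT \<xi>|lebesgue. gauss (c *\<^sub>R \<xi>) * (cmod (osc_integral \<sigma> u \<xi>))\<^sup>2) =
      (LINT p|(lebesgue \<Otimes>\<^sub>M lebesgue).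
        u (fst p) * cnj (u (snd p)) * of_real (gauss ((1 / c) *\<^sub>R (fst p - snd p)) / c ^ DIM('a)))" (is ?C)
proof -
  define L where "L = (lebesgue :: 'a measure)"
  define P where "P = L \<Otimes>\<^sub>M L"
  interpret P: pair_sigma_finite L L
    unfolding L_def by (rule pair_sigma_finite_lebesgue)
  interpret Q: pair_sigma_finite L P
    unfolding P_def by standard
  have uL: "integrable L u" and ucL: "integrable L (\<lambda>x. cnj (u x))"
    using u by (auto simp: L_def)
  have [measurable]: "u \<in> borel_measurable L"
    using uL by auto
  define w where "w \<xi> p = complex_of_real (gauss (c *\<^sub>R \<xi>)) *
    (cis (2 * pi * (\<sigma> * (\<xi> \<bullet> (fst p - snd p)))) * (u (fst p) * cnj (u (snd p))))" for \<xi> and p :: "'a \<times> 'a"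
  have g_int: "integrable L (\<lambda>\<xi>. complex_of_real (gauss (c *\<^sub>R \<xi>)))"
    using gauss_scaled_integrable[of c "0::'a"] c unfolding L_def by (intro integrable_of_real) simp
  have "integrable P (\<lambda>p. u (fst p) * cnj (u (snd p)))"
    unfolding P_def using uL ucL by (rule P.integrable_tensor)
  from Q.integrable_tensor(1)[OF g_int this]
  have bound: "integrable (L \<Otimes>\<^sub>M P)
      (\<lambda>q. complex_of_real (gauss (c *\<^sub>R fst q)) * (u (fst (snd q)) * cnj (u (snd (snd q)))))" .
  have [measurable]: "(\<lambda>q. fst q) \<in> borel_measurable (L \<Otimes>\<^sub>M (L \<Otimes>\<^sub>M L))"
    "(\<lambda>q. fst (snd q)) \<in> borel_measurable (L \<Otimes>\<^sub>M (L \<Otimes>\<^sub>M L))"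
    "(\<lambda>q. snd (snd q)) \<in> borel_measurable (L \<Otimes>\<^sub>M (L \<Otimes>\<^sub>M L))"
    unfolding L_def by (intro measurable_lebesgue_imp_borel; measurable)+
  have w_int: "integrable (L \<Otimes>\<^sub>M P) (\<lambda>(\<xi>, p). w \<xi> p)"
  proof (rule Bochner_Integration.integrable_bound[OF bound])
    show "(\<lambda>(\<xi>, p). w \<xi> p) \<in> borel_measurable (L \<Otimes>\<^sub>M P)"
      unfolding w_def case_prod_beta P_def by measurable
    show "AE q in L \<Otimes>\<^sub>M P. norm (case q of (\<xi>, p) \<Rightarrow> w \<xi> p) \<le>
        norm (complex_of_real (gauss (c *\<^sub>R fst q)) * (u (fst (snd q)) * cnj (u (snd (snd q)))))"
      by (simp add: w_def case_prod_beta norm_mult)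
  qed
  have inner_P: "(LINT p|P. w \<xi> p) = of_real (gauss (c *\<^sub>R \<xi>) * (cmod (osc_integral \<sigma> u \<xi>))\<^sup>2)" for \<xi>
  proof -
    define f where "f x = cis (2 * pi * (\<sigma> * (\<xi> \<bullet> x))) * u x" for x
    have f: "integrable L f"
      unfolding f_def L_def by (rule osc_integrand_integrable[OF u])
    have w_eq: "w \<xi> p = complex_of_real (gauss (c *\<^sub>R \<xi>)) * (f (fst p) * cnj (f (snd p)))" for p
    proof -
      have "cis (2 * pi * (\<sigma> * (\<xi> \<bullet> (fst p - snd p)))) =
          cis (2 * pi * (\<sigma> * (\<xi> \<bullet> fst p))) * cnj (cis (2 * pi * (\<sigma> * (\<xi> \<bullet> snd p))))"
        by (simp add: cis_cnj cis_mult inner_diff_right algebra_simps)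
      then show ?thesis
        by (simp add: w_def f_def mult_ac)
    qed
    have "(LINT p|P. w \<xi> p) = complex_of_real (gauss (c *\<^sub>R \<xi>)) * (integral\<^sup>L L f * integral\<^sup>L L (\<lambda>x. cnj (f x)))"
      unfolding w_eq P_def using P.integrable_tensor(2)[OF f integrable_cnj[OF f]] by simp
    also have "integral\<^sup>L L f = osc_integral \<sigma> u \<xi>"
      by (simp add: osc_integral_def f_def[abs_def] L_def)
    also have "integral\<^sup>L L (\<lambda>x. cnj (f x)) = cnj (osc_integral \<sigma> u \<xi>)"
      unfolding Bochner_Integration.integral_cnj by (simp add: osc_integral_def f_def[abs_def] L_def)
    finally show ?thesis
      by (simp only: of_real_mult complex_norm_square)
  qed
  have inner_L: "(LINT \<xi>|L. w \<xi> p) = u (fst p) * cnj (u (snd p)) *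
      of_real (gauss ((1 / c) *\<^sub>R (fst p - snd p)) / c ^ DIM('a))" for p
  proof -
    have "w \<xi> p = (cis (2 * pi * ((\<sigma> *\<^sub>R (fst p - snd p)) \<bullet> \<xi>)) * of_real (gauss (c *\<^sub>R \<xi>))) *
        (u (fst p) * cnj (u (snd p)))" for \<xi>
      unfolding w_def by (simp add: inner_commute mult_ac)
    then have "(LINT \<xi>|L. w \<xi> p) =
        (LINT \<xi>|L. cis (2 * pi * ((\<sigma> *\<^sub>R (fst p - snd p)) \<bullet> \<xi>)) * of_real (gauss (c *\<^sub>R \<xi>))) *
        (u (fst p) * cnj (u (snd p)))"
      by simp
    moreover have "gauss ((1 / c) *\<^sub>R \<sigma> *\<^sub>R z) = gauss ((1 / c) *\<^sub>R z)" for z :: 'a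
      using \<sigma> by (simp add: gauss_def)
    ultimately show ?thesis
      unfolding L_def fourier_gauss_scaled[OF c] by simp
  qed
  have "integrable L (\<lambda>\<xi>. complex_of_real (gauss (c *\<^sub>R \<xi>) * (cmod (osc_integral \<sigma> u \<xi>))\<^sup>2))"
    using Q.integrable_fst[OF w_int] unfolding inner_P .
  then show ?A
    unfolding complex_of_real_integrable_eq L_def .
  show ?B
    using Q.integrable_snd[OF w_int] unfolding inner_L unfolding P_def L_def .
  show ?C
    using Q.Fubini_integral[OF w_int] unfolding inner_P inner_L
    unfolding P_def L_def by (simp only: integral_complex_of_real)
qed

section \<open>Plancherel's theorem on dense subspaces\<close>

text \<open>
  The Gaussian kernel \<open>k (x - y)\<close> is nonnegative with integral 1 in each variable. Hence
  \<open>\<bar>u(x) u(y)\<bar> \<le> (\<bar>u(x)\<bar>\<^sup>2 + \<bar>u(y)\<bar>\<^sup>2) / 2\<close> bounds the damped norm of the transform by that of \<open>u\<close>,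
  for every damping parameter. Fatou's lemma removes the damping.
\<close>

lemma osc_integral_bessel:
  fixes u :: "'a::euclidean_space \<Rightarrow> complex"
  assumes u: "integrable lebesgue u" "u \<in> L2_space" and \<sigma>: "\<bar>\<sigma>\<bar> = 1"
  shows "osc_integral \<sigma> u \<in> L2_space" "L2_norm (osc_integral \<sigma> u) \<le> L2_norm u"
proof -
  interpret pair_sigma_finite "lebesgue :: 'a measure" "lebesgue :: 'a measure"
    by (rule pair_sigma_finite_lebesgue)
  note meas [measurable] = L2_space_measurable[OF u(2)]
  have [measurable]: "fst \<in> borel_measurable ((lebesgue :: 'a measure) \<Otimes>\<^sub>M (lebesgue :: 'a measure))"
    "snd \<in> borel_measurable ((lebesgue :: 'a measure) \<Otimes>\<^sub>M (lebesgue :: 'a measure))"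
    by (intro measurable_lebesgue_imp_borel; measurable)+
  have le: "(LINT \<xi>|lebesgue. gauss (c *\<^sub>R \<xi>) * (cmod (osc_integral \<sigma> u \<xi>))\<^sup>2) \<le> (L2_norm u)\<^sup>2"
    if c: "0 < c" for c
  proof -
    define k where "k z = gauss ((1 / c) *\<^sub>R z) / c ^ DIM('a)" for z :: 'a
    have k_meas [measurable]: "k \<in> borel_measurable borel"
      unfolding k_def by measurable
    have k_nn: "0 \<le> k z" for z
      using c by (simp add: k_def)
    have k_int: "integrable lebesgue (\<lambda>y. k (x - y))" "(LINT y|lebesgue. k (x - y)) = 1" for x
      using c gauss_scaled_integrable[of "- (1 / c)" "(1 / c) *\<^sub>R x"]
        gauss_scaled_integral[of "- (1 / c)" "(1 / c) *\<^sub>R x"]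
      by (simp_all add: k_def scaleR_diff_right power_one_over field_simps)
    define A where "A p = (cmod (u (fst p)))\<^sup>2 * k (fst p - snd p)" for p
    define B where "B p = (cmod (u (snd p)))\<^sup>2 * k (fst p - snd p)" for p
    have A: "integrable (lebesgue \<Otimes>\<^sub>M lebesgue) A"
    proof (rule Fubini_integrable)
      show "A \<in> borel_measurable (lebesgue \<Otimes>\<^sub>M lebesgue)"
        unfolding A_def by measurable
      show "integrable lebesgue (\<lambda>x. LINT y|lebesgue. norm (A (x, y)))"
        using L2_space_integrable_square[OF u(2)] k_int(2) by (simp add: A_def abs_mult k_nn)
      show "AE x in lebesgue. integrable lebesgue (\<lambda>y. A (x, y))"
        using k_int(1) by (simp add: A_def)
    qed
    have A_lint: "(LINT p|(lebesgue \<Otimes>\<^sub>M lebesgue). A p) = (L2_norm u)\<^sup>2"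
    proof -
      have "(LINT y|lebesgue. A (x, y)) = (cmod (u x))\<^sup>2" for x
        by (simp add: A_def k_int(2))
      then show ?thesis
        using integral_fst'[OF A] by (simp add: L2_norm_power2)
    qed
    have k_even: "k (x - y) = k (y - x)" for x y
      unfolding k_def by (metis gauss_minus minus_diff_eq scaleR_minus_right)
    have B_eq: "B = (\<lambda>(x, y). A (y, x))"
      by (auto simp: A_def B_def k_even)
    have B: "integrable (lebesgue \<Otimes>\<^sub>M lebesgue) B"
      unfolding B_eq by (rule integrable_product_swap[OF A])
    have B_lint: "(LINT p|(lebesgue \<Otimes>\<^sub>M lebesgue). B p) = (L2_norm u)\<^sup>2"
      unfolding B_eq using integral_product_swap[of A] A A_lint by simp
    have "\<bar>LINT \<xi>|lebesgue. gauss (c *\<^sub>R \<xi>) * (cmod (osc_integral \<sigma> u \<xi>))\<^sup>2\<bar> =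
        cmod (complex_of_real (LINT \<xi>|lebesgue. gauss (c *\<^sub>R \<xi>) * (cmod (osc_integral \<sigma> u \<xi>))\<^sup>2))"
      by (rule norm_of_real[symmetric])
    also have "\<dots> =
        cmod (LINT p|(lebesgue \<Otimes>\<^sub>M lebesgue). u (fst p) * cnj (u (snd p)) * of_real (k (fst p - snd p)))"
      unfolding gauss_weighted_plancherel(3)[OF u(1) c \<sigma>] k_def ..
    also have "\<dots> \<le> (LINT p|(lebesgue \<Otimes>\<^sub>M lebesgue). (A p + B p) / 2)"
    proof (rule order_trans[OF integral_norm_bound integral_mono])
      show "integrable (lebesgue \<Otimes>\<^sub>M lebesgue)
          (\<lambda>p. norm (u (fst p) * cnj (u (snd p)) * of_real (k (fst p - snd p))))"
        using gauss_weighted_plancherel(2)[OF u(1) c \<sigma>] unfolding k_def by (rule integrable_norm)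
      show "integrable (lebesgue \<Otimes>\<^sub>M lebesgue) (\<lambda>p. (A p + B p) / 2)"
        using A B by simp
      fix p :: "'a \<times> 'a"
      have "cmod (u (fst p)) * cmod (u (snd p)) \<le> ((cmod (u (fst p)))\<^sup>2 + (cmod (u (snd p)))\<^sup>2) / 2"
        using sum_squares_bound[of "cmod (u (fst p))" "cmod (u (snd p))"] by simp
      from mult_right_mono[OF this k_nn[of "fst p - snd p"]]
      show "norm (u (fst p) * cnj (u (snd p)) * of_real (k (fst p - snd p))) \<le> (A p + B p) / 2"
        using k_nn by (simp add: A_def B_def norm_mult distrib_right add_divide_distrib)
    qed
    also have "\<dots> = (L2_norm u)\<^sup>2"
      using A B A_lint B_lint by simp
    finally show ?thesis
      by simp
  qed
  define c where "c n = inverse (real (Suc n))" for n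
  have c: "0 < c n" "c \<longlonglongrightarrow> 0" for n
    using LIMSEQ_inverse_real_of_nat by (simp_all add: c_def[abs_def] del: of_nat_Suc)
  have conv: "(\<lambda>n. gauss (c n *\<^sub>R \<xi>) * (cmod (osc_integral \<sigma> u \<xi>))\<^sup>2) \<longlonglongrightarrow> (cmod (osc_integral \<sigma> u \<xi>))\<^sup>2" for \<xi> :: 'a
    using c(2) by (rule gauss_damping_tendsto)
  have "integrable lebesgue (\<lambda>\<xi>. (cmod (osc_integral \<sigma> u \<xi>))\<^sup>2) \<and>
      (LINT \<xi>|lebesgue. (cmod (osc_integral \<sigma> u \<xi>))\<^sup>2) \<le> (L2_norm u)\<^sup>2"
  proof (intro conjI; rule integrable_Fatou[where f="\<lambda>n \<xi>. gauss (c n *\<^sub>R \<xi>) * (cmod (osc_integral \<sigma> u \<xi>))\<^sup>2"])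
  qed (use gauss_weighted_plancherel(1)[OF u(1) c(1) \<sigma>] le[OF c(1)] conv
      osc_integral_measurable[OF meas, of \<sigma>] in auto)
  then show "osc_integral \<sigma> u \<in> L2_space" "L2_norm (osc_integral \<sigma> u) \<le> L2_norm u"
    using osc_integral_measurable[OF meas, of \<sigma>]
    by (auto simp: L2_space_def L2_norm_power2[symmetric] intro: power2_le_imp_le)
qed

text \<open>
  For continuous \<open>u\<close> with compact support both sides of \<open>gauss_weighted_plancherel\<close> converge as the
  damping disappears: the substitution \<open>y = x - c z\<close> turns the right-hand side into an integral of
  \<open>u(x) cnj (u(x - c z)) gauss z\<close>, to which dominated convergence applies.
\<close>

lemma osc_integral_isometry_cc:
  fixes u :: "'a::euclidean_space \<Rightarrow> complex"
  assumes u: "cc_function u" and \<sigma>: "\<bar>\<sigma>\<bar> = 1"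
  shows "L2_norm (osc_integral \<sigma> u) = L2_norm u"
proof -
  interpret pair_sigma_finite "lebesgue :: 'a measure" "lebesgue :: 'a measure"
    by (rule pair_sigma_finite_lebesgue)
  note u_int = cc_function_integrable[OF u]
  note [measurable] = cc_function_measurable[OF u] L2_space_measurable[OF u_int(2)]
  note fu = osc_integral_bessel[OF u_int \<sigma>]
  obtain M where M: "\<And>x. cmod (u x) \<le> M"
    using cc_function_bounded[OF u] by blast
  have M0: "0 \<le> M"
    using M[of 0] norm_ge_zero order_trans by blast
  have u_cont: "isCont u x" for x
    using u by (simp add: cc_function_def continuous_on_eq_continuous_at)
  define c where "c n = inverse (real (Suc n))" for n
  have c: "0 < c n" "c \<longlonglongrightarrow> 0" for n
    using LIMSEQ_inverse_real_of_nat by (simp_all add: c_def[abs_def] del: of_nat_Suc)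
  define I where "I n = (LINT \<xi>|lebesgue. gauss (c n *\<^sub>R \<xi>) * (cmod (osc_integral \<sigma> u \<xi>))\<^sup>2)" for n
  \<comment> \<open>\<open>h n\<close> is the conjugate of \<open>u\<close> smoothed at scale \<open>c n\<close>.\<close>
  define h where "h n x = (LINT z|lebesgue. cnj (u (x - c n *\<^sub>R z)) * of_real (gauss z))" for n x
  have "I \<longlonglongrightarrow> (LINT \<xi>|lebesgue. (cmod (osc_integral \<sigma> u \<xi>))\<^sup>2)"
    unfolding I_def
  proof (rule integral_dominated_convergence[OF _ _ L2_space_integrable_square[OF fu(1)]])
    show "AE \<xi> in lebesgue. (\<lambda>n. gauss (c n *\<^sub>R \<xi>) * (cmod (osc_integral \<sigma> u \<xi>))\<^sup>2) \<longlonglongrightarrow>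
        (cmod (osc_integral \<sigma> u \<xi>))\<^sup>2"
      by (intro AE_I2 gauss_damping_tendsto c(2))
    show "AE \<xi> in lebesgue. norm (gauss (c n *\<^sub>R \<xi>) * (cmod (osc_integral \<sigma> u \<xi>))\<^sup>2) \<le>
        (cmod (osc_integral \<sigma> u \<xi>))\<^sup>2" for n
      by (simp add: abs_mult mult_left_le_one_le gauss_le_1)
    show "(\<lambda>\<xi>. gauss (c n *\<^sub>R \<xi>) * (cmod (osc_integral \<sigma> u \<xi>))\<^sup>2) \<in> borel_measurable lebesgue" for n
      using gauss_weighted_plancherel(1)[OF u_int(1) c(1) \<sigma>] by (rule borel_measurable_integrable)
  qed (use L2_space_integrable_square[OF fu(1)] in auto)
  then have lim1: "(\<lambda>n. complex_of_real (I n)) \<longlonglongrightarrow> of_real ((L2_norm (osc_integral \<sigma> u))\<^sup>2)"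
    unfolding L2_norm_power2 by (rule tendsto_of_real)
  have I_eq: "integrable lebesgue (\<lambda>x. u x * h n x) \<and> complex_of_real (I n) = (LINT x|lebesgue. u x * h n x)" for n
  proof -
    define F where "F p = u (fst p) * cnj (u (snd p)) *
      of_real (gauss ((1 / c n) *\<^sub>R (fst p - snd p)) / c n ^ DIM('a))" for p
    have F: "integrable (lebesgue \<Otimes>\<^sub>M lebesgue) F"
      and FI: "complex_of_real (I n) = (LINT p|(lebesgue \<Otimes>\<^sub>M lebesgue). F p)"
      using gauss_weighted_plancherel(2,3)[OF u_int(1) c(1)[of n] \<sigma>]
      unfolding F_def I_def by blast+
    have "(LINT y|lebesgue. F (x, y)) = u x * h n x" for x
    proof -
      define g where "g y = cnj (u y) * of_real (gauss ((1 / c n) *\<^sub>R (x - y)))" for y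
      have g: "g \<in> borel_measurable borel"
        unfolding g_def by measurable
      have "(LINT z|lebesgue. g (x + (- c n) *\<^sub>R z)) = (1 / \<bar>- c n\<bar> ^ DIM('a)) *\<^sub>R (LINT y|lebesgue. g y)"
        using c(1)[of n] by (intro lebesgue_integral_affine g) simp
      moreover have "g (x + (- c n) *\<^sub>R z) = cnj (u (x - c n *\<^sub>R z)) * of_real (gauss z)" for z
        using c(1)[of n] by (simp add: g_def)
      ultimately have "h n x = (LINT y|lebesgue. g y) / of_real (c n ^ DIM('a))"
        using c(1)[of n] by (simp add: h_def scaleR_conv_of_real)
      moreover have "(LINT y|lebesgue. F (x, y)) = (LINT y|lebesgue. (u x / of_real (c n ^ DIM('a))) * g y)"
        by (intro Bochner_Integration.integral_cong) (auto simp: F_def g_def)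
      ultimately show ?thesis
        by simp
    qed
    then show ?thesis
      using integrable_fst'[OF F] integral_fst'[OF F] FI by simp
  qed
  have lim_h: "(\<lambda>n. h n x) \<longlonglongrightarrow> cnj (u x)" for x
  proof -
    have "(\<lambda>n. h n x) \<longlonglongrightarrow> (LINT z::'a|lebesgue. cnj (u x) * of_real (gauss z))"
      unfolding h_def
    proof (rule integral_dominated_convergence[where w="\<lambda>z. M * gauss z"])
      show "integrable lebesgue (\<lambda>z::'a. M * gauss z)"
        by (simp add: gauss_integrable)
      show "(\<lambda>z. cnj (u x) * complex_of_real (gauss z)) \<in> borel_measurable lebesgue"
        by (rule borel_imp_lebesgue_measurable) measurable
      show "(\<lambda>z. cnj (u (x - c n *\<^sub>R z)) * complex_of_real (gauss z)) \<in> borel_measurable lebesgue" for n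
        by (rule borel_imp_lebesgue_measurable) measurable
      show "AE z in lebesgue. (\<lambda>n. cnj (u (x - c n *\<^sub>R z)) * complex_of_real (gauss z)) \<longlonglongrightarrow>
          cnj (u x) * complex_of_real (gauss z)"
      proof (rule AE_I2)
        fix z :: 'a
        have "(\<lambda>n. x - c n *\<^sub>R z) \<longlonglongrightarrow> x - 0 *\<^sub>R z"
          using c(2) by (intro tendsto_intros)
        then have "(\<lambda>n. u (x - c n *\<^sub>R z)) \<longlonglongrightarrow> u x"
          by (intro isCont_tendsto_compose[OF u_cont]) simp
        then show "(\<lambda>n. cnj (u (x - c n *\<^sub>R z)) * complex_of_real (gauss z)) \<longlonglongrightarrow>
            cnj (u x) * complex_of_real (gauss z)"
          by (intro tendsto_intros)
      qed
      show "AE z in lebesgue. norm (cnj (u (x - c n *\<^sub>R z)) * complex_of_real (gauss z)) \<le> M * gauss z" for n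
        using M by (simp add: norm_mult mult_right_mono)
    qed
    also have "(LINT z::'a|lebesgue. cnj (u x) * of_real (gauss z)) = cnj (u x)"
      by (simp add: gauss_integral)
    finally show ?thesis .
  qed
  have h_bound: "cmod (h n x) \<le> M" for n x
  proof -
    have "cmod (h n x) \<le> (LINT z|lebesgue. norm (cnj (u (x - c n *\<^sub>R z)) * of_real (gauss z)))"
      unfolding h_def by (rule integral_norm_bound)
    also have "\<dots> \<le> (LINT z::'a|lebesgue. M * gauss z)"
    proof (rule integral_mono')
      show "integrable lebesgue (\<lambda>z::'a. M * gauss z)"
        by (simp add: gauss_integrable)
    qed (use M M0 in \<open>auto simp: norm_mult intro: mult_right_mono\<close>)
    finally show ?thesis
      by (simp add: gauss_integral)
  qed
  have "(\<lambda>n. LINT x|lebesgue. u x * h n x) \<longlonglongrightarrow> (LINT x|lebesgue. u x * cnj (u x))"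
  proof (rule integral_dominated_convergence[where w="\<lambda>x. cmod (u x) * M"])
    show "AE x in lebesgue. (\<lambda>n. u x * h n x) \<longlonglongrightarrow> u x * cnj (u x)"
      by (intro AE_I2 tendsto_intros lim_h)
    show "AE x in lebesgue. norm (u x * h n x) \<le> cmod (u x) * M" for n
      using h_bound by (simp add: norm_mult mult_left_mono)
    show "(\<lambda>x. u x * h n x) \<in> borel_measurable lebesgue" for n
      using I_eq by (blast intro: borel_measurable_integrable)
  qed (use u_int in auto)
  then have "(\<lambda>n. complex_of_real (I n)) \<longlonglongrightarrow> L2_inner u u"
    using I_eq by (simp add: L2_inner_def)
  with lim1 have "complex_of_real ((L2_norm (osc_integral \<sigma> u))\<^sup>2) = of_real ((L2_norm u)\<^sup>2)"
    unfolding L2_inner_self by (rule LIMSEQ_unique)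
  then show ?thesis
    by (simp only: of_real_eq_iff) (simp add: power2_eq_iff_nonneg)
qed

lemma osc_integral_adjoint:
  fixes u v :: "'a::euclidean_space \<Rightarrow> complex"
  assumes u: "integrable lebesgue u" and v: "integrable lebesgue v"
  shows "L2_inner (osc_integral \<sigma> u) v = L2_inner u (osc_integral (- \<sigma>) v)"
proof -
  interpret pair_sigma_finite "lebesgue :: 'a measure" "lebesgue :: 'a measure"
    by (rule pair_sigma_finite_lebesgue)
  have [measurable]: "u \<in> borel_measurable lebesgue" "v \<in> borel_measurable lebesgue"
    using u v by auto
  have [measurable]: "fst \<in> borel_measurable ((lebesgue :: 'a measure) \<Otimes>\<^sub>M (lebesgue :: 'a measure))"
    "snd \<in> borel_measurable ((lebesgue :: 'a measure) \<Otimes>\<^sub>M (lebesgue :: 'a measure))"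
    by (intro measurable_lebesgue_imp_borel; measurable)+
  define F where "F x \<xi> = cis (2 * pi * (\<sigma> * (\<xi> \<bullet> x))) * (u x * cnj (v \<xi>))" for x \<xi>
  have F: "integrable (lebesgue \<Otimes>\<^sub>M lebesgue) (case_prod F)"
  proof (rule Bochner_Integration.integrable_bound[OF integrable_tensor(1)[OF u integrable_cnj[OF v]]])
    show "case_prod F \<in> borel_measurable (lebesgue \<Otimes>\<^sub>M lebesgue)"
      unfolding F_def case_prod_beta by measurable
  qed (simp add: F_def case_prod_beta norm_mult)
  have "L2_inner (osc_integral \<sigma> u) v = (LINT \<xi>|lebesgue. LINT x|lebesgue. F x \<xi>)"
    unfolding L2_inner_def osc_integral_def F_def
    by (simp add: mult.assoc[symmetric])
  also have "\<dots> = (LINT x|lebesgue. LINT \<xi>|lebesgue. F x \<xi>)"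
    by (rule Fubini_integral[OF F])
  also have "\<dots> = (LINT x|lebesgue. u x * cnj (osc_integral (- \<sigma>) v x))"
  proof (rule Bochner_Integration.integral_cong[OF refl])
    fix x
    have "cnj (osc_integral (- \<sigma>) v x) = (LINT \<xi>|lebesgue. cnj (cis (2 * pi * (- \<sigma> * (x \<bullet> \<xi>))) * v \<xi>))"
      unfolding osc_integral_def by (rule Bochner_Integration.integral_cnj[symmetric])
    then have "u x * cnj (osc_integral (- \<sigma>) v x) =
        (LINT \<xi>|lebesgue. u x * cnj (cis (2 * pi * (- \<sigma> * (x \<bullet> \<xi>))) * v \<xi>))"
      by simp
    also have "\<dots> = (LINT \<xi>|lebesgue. F x \<xi>)"
      by (intro Bochner_Integration.integral_cong) (auto simp: F_def cis_cnj inner_commute)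
    finally show "(LINT \<xi>|lebesgue. F x \<xi>) = u x * cnj (osc_integral (- \<sigma>) v x)" ..
  qed
  finally show ?thesis
    by (simp add: L2_inner_def)
qed

section \<open>The Fourier transform as an operator on L2\<close>

lemma osc_integral_lincomb:
  assumes "integrable lebesgue u" "integrable lebesgue v"
  shows "osc_integral \<sigma> (\<lambda>x. a * u x + b * v x) = (\<lambda>\<xi>. a * osc_integral \<sigma> u \<xi> + b * osc_integral \<sigma> v \<xi>)"
proof
  fix \<xi>
  have "cis (2 * pi * (\<sigma> * (\<xi> \<bullet> x))) * (a * u x + b * v x) =
      a * (cis (2 * pi * (\<sigma> * (\<xi> \<bullet> x))) * u x) + b * (cis (2 * pi * (\<sigma> * (\<xi> \<bullet> x))) * v x)" for x
    by (simp add: algebra_simps)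
  then show "osc_integral \<sigma> (\<lambda>x. a * u x + b * v x) \<xi> = a * osc_integral \<sigma> u \<xi> + b * osc_integral \<sigma> v \<xi>"
    using osc_integrand_integrable[OF assms(1), of \<sigma> \<xi>] osc_integrand_integrable[OF assms(2), of \<sigma> \<xi>]
    by (simp add: osc_integral_def)
qed

text \<open>
  The graph of the extended transform: \<open>osc_limit \<sigma> u g\<close> says that \<open>g\<close> is the limit in the mean of the
  transforms of some integrable functions converging to \<open>u\<close> in the mean. For \<open>\<bar>\<sigma>\<bar> = 1\<close> it is the
  graph of a linear contraction on \<open>L\<^sub>2\<close>, up to null sets.
\<close>

definition osc_limit :: "real \<Rightarrow> ('a::euclidean_space \<Rightarrow> complex) \<Rightarrow> ('a \<Rightarrow> complex) \<Rightarrow> bool" where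
  "osc_limit \<sigma> u g \<longleftrightarrow> (\<exists>f. (\<forall>n. integrable lebesgue (f n)) \<and> L2_tendsto f u \<and>
     L2_tendsto (\<lambda>n. osc_integral \<sigma> (f n)) g)"

lemma osc_limit_L2: "osc_limit \<sigma> u g \<Longrightarrow> u \<in> L2_space" "osc_limit \<sigma> u g \<Longrightarrow> g \<in> L2_space"
  by (auto simp: osc_limit_def L2_tendsto_def)

lemma osc_limit_lincomb:
  assumes "osc_limit \<sigma> u g" "osc_limit \<sigma> v h"
  shows "osc_limit \<sigma> (\<lambda>x. a * u x + b * v x) (\<lambda>x. a * g x + b * h x)"
proof -
  obtain f f' where f: "\<And>n. integrable lebesgue (f n)" "L2_tendsto f u" "L2_tendsto (\<lambda>n. osc_integral \<sigma> (f n)) g"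
    and f': "\<And>n. integrable lebesgue (f' n)" "L2_tendsto f' v" "L2_tendsto (\<lambda>n. osc_integral \<sigma> (f' n)) h"
    using assms by (auto simp: osc_limit_def)
  have "L2_tendsto (\<lambda>n. osc_integral \<sigma> (\<lambda>x. a * f n x + b * f' n x)) (\<lambda>x. a * g x + b * h x)"
    unfolding osc_integral_lincomb[OF f(1) f'(1)] by (rule L2_tendsto_lincomb[OF f(3) f'(3)])
  moreover have "L2_tendsto (\<lambda>n x. a * f n x + b * f' n x) (\<lambda>x. a * u x + b * v x)"
    by (rule L2_tendsto_lincomb[OF f(2) f'(2)])
  moreover have "integrable lebesgue (\<lambda>x. a * f n x + b * f' n x)" for n
    using f(1) f'(1) by simp
  ultimately show ?thesis
    unfolding osc_limit_def by (intro exI[of _ "\<lambda>n x. a * f n x + b * f' n x"]) simp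
qed

lemma osc_limit_norm_le:
  assumes "osc_limit \<sigma> u g" "\<bar>\<sigma>\<bar> = 1"
  shows "L2_norm g \<le> L2_norm u"
proof -
  obtain f where f: "\<And>n. integrable lebesgue (f n)" "L2_tendsto f u" "L2_tendsto (\<lambda>n. osc_integral \<sigma> (f n)) g"
    using assms(1) by (auto simp: osc_limit_def)
  show ?thesis
  proof (rule LIMSEQ_le[OF L2_tendsto_norm[OF f(3)] L2_tendsto_norm[OF f(2)]])
    have "L2_norm (osc_integral \<sigma> (f n)) \<le> L2_norm (f n)" for n
      using f(1,2) assms(2) by (intro osc_integral_bessel) (auto simp: L2_tendsto_def)
    then show "\<exists>N. \<forall>n\<ge>N. L2_norm (osc_integral \<sigma> (f n)) \<le> L2_norm (f n)"
      by blast
  qed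
qed

lemma osc_limit_unique_AE:
  assumes "osc_limit \<sigma> u g" "osc_limit \<sigma> u h" "\<bar>\<sigma>\<bar> = 1"
  shows "AE x in lebesgue. g x = h x"
proof -
  have "L2_norm (\<lambda>x. 1 * g x + (- 1) * h x) \<le> L2_norm (\<lambda>x. 1 * u x + (- 1) * u x)"
    by (rule osc_limit_norm_le[OF osc_limit_lincomb[OF assms(1,2)] assms(3)])
  then have "L2_norm (\<lambda>x. g x - h x) = 0"
    by (simp add: L2_norm_def[of "\<lambda>x. 0"] order_antisym)
  then show ?thesis
    using L2_norm_eq_0_iff[OF L2_space_diff[OF osc_limit_L2(2)[OF assms(1)] osc_limit_L2(2)[OF assms(2)]]]
    by simp
qed

lemma osc_limit_exists:
  assumes u: "u \<in> L2_space" and \<sigma>: "\<bar>\<sigma>\<bar> = 1"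
  shows "\<exists>g. osc_limit \<sigma> u g"
proof -
  obtain f where f: "L2_tendsto f u" "\<And>n. cc_function (f n)"
    using cc_function_dense[OF u] by blast
  note f_int = cc_function_integrable[OF f(2)]
  have "\<exists>g. L2_tendsto (\<lambda>n. osc_integral \<sigma> (f n)) g"
  proof (rule L2_complete)
    show "osc_integral \<sigma> (f n) \<in> L2_space" for n
      by (rule osc_integral_bessel[OF f_int \<sigma>])
    fix e :: real
    assume "0 < e"
    then have "\<forall>\<^sub>F n in sequentially. L2_norm (\<lambda>x. f n x - u x) < e / 2"
      using f(1) by (intro order_tendstoD(2)[where y=0]) (auto simp: L2_tendsto_def)
    then obtain K where K: "\<And>n. K \<le> n \<Longrightarrow> L2_norm (\<lambda>x. f n x - u x) < e / 2"
      by (auto simp: eventually_sequentially)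
    have "L2_norm (\<lambda>x. osc_integral \<sigma> (f m) x - osc_integral \<sigma> (f n) x) < e" if "K \<le> m" "K \<le> n" for m n
    proof -
      have "(\<lambda>x. osc_integral \<sigma> (f m) x - osc_integral \<sigma> (f n) x) = osc_integral \<sigma> (\<lambda>x. f m x - f n x)"
        using osc_integral_lincomb[OF f_int(1) f_int(1), of \<sigma> 1 m "- 1" n] by simp
      then have "L2_norm (\<lambda>x. osc_integral \<sigma> (f m) x - osc_integral \<sigma> (f n) x) \<le> L2_norm (\<lambda>x. f m x - f n x)"
        using osc_integral_bessel(2)[OF Bochner_Integration.integrable_diff[OF f_int(1) f_int(1)]
            L2_space_diff[OF f_int(2) f_int(2)] \<sigma>, of m n]
        by simp
      also have "\<dots> \<le> L2_norm (\<lambda>x. f m x - u x) + L2_norm (\<lambda>x. u x - f n x)"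
        by (intro L2_dist_triangle f_int u)
      also have "\<dots> < e"
        using K[OF that(1)] K[OF that(2)] by (simp add: L2_norm_diff_commute[of u])
      finally show ?thesis .
    qed
    then show "\<exists>K. \<forall>m\<ge>K. \<forall>n\<ge>K. L2_norm (\<lambda>x. osc_integral \<sigma> (f m) x - osc_integral \<sigma> (f n) x) < e"
      by blast
  qed
  then show ?thesis
    using f(1) f_int(1) unfolding osc_limit_def by blast
qed

lemma osc_limit_integrable:
  assumes "integrable lebesgue u" "u \<in> L2_space" "\<bar>\<sigma>\<bar> = 1"
  shows "osc_limit \<sigma> u (osc_integral \<sigma> u)"
  unfolding osc_limit_def L2_tendsto_def using assms osc_integral_bessel(1)[OF assms]
  by (intro exI[of _ "\<lambda>_. u"]) (simp add: L2_norm_def)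

theorem osc_bounded_extension_exists:
  assumes \<sigma>: "\<bar>\<sigma>\<bar> = 1"
  shows "\<exists>T. L2_bounded_extension (osc_integral \<sigma> :: ('a::euclidean_space \<Rightarrow> complex) \<Rightarrow> 'a \<Rightarrow> complex) T"
proof -
  define T :: "('a \<Rightarrow> complex) \<Rightarrow> 'a \<Rightarrow> complex" where "T u = (SOME g. osc_limit \<sigma> u g)" for u
  have T: "osc_limit \<sigma> u (T u)" if "u \<in> L2_space" for u
    unfolding T_def using osc_limit_exists[OF that \<sigma>] by (rule someI_ex)
  have "L2_bounded_extension (osc_integral \<sigma>) T"
    unfolding L2_bounded_extension_def
  proof (intro conjI ballI allI impI)
    show "T u \<in> L2_space" if "u \<in> L2_space" for u
      by (rule osc_limit_L2(2)[OF T[OF that]])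
  next
    fix u v :: "'a \<Rightarrow> complex" and a b
    assume "u \<in> L2_space" "v \<in> L2_space"
    then show "AE x in lebesgue. T (\<lambda>y. a * u y + b * v y) x = a * T u x + b * T v x"
      by (intro osc_limit_unique_AE[OF T osc_limit_lincomb[OF T T] \<sigma>] L2_space_lincomb)
  next
    show "\<exists>C. \<forall>u\<in>L2_space. L2_norm (T u) \<le> C * L2_norm u"
      using osc_limit_norm_le[OF T \<sigma>] by (intro exI[of _ 1]) simp
  next
    fix u :: "'a \<Rightarrow> complex"
    assume "u \<in> L2_space" "integrable lebesgue u"
    then show "AE x in lebesgue. T u x = osc_integral \<sigma> u x"
      by (intro osc_limit_unique_AE[OF T osc_limit_integrable \<sigma>] \<sigma>)
  qed
  then show ?thesis
    by blast
qed

lemma L2_bounded_extensionD: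
  assumes "L2_bounded_extension T\<^sub>0 T"
  shows L2_extension_in_L2: "u \<in> L2_space \<Longrightarrow> T u \<in> L2_space"
    and L2_extension_diff: "u \<in> L2_space \<Longrightarrow> v \<in> L2_space \<Longrightarrow>
      AE x in lebesgue. T (\<lambda>y. u y - v y) x = T u x - T v x"
    and L2_extension_eq: "u \<in> L2_space \<Longrightarrow> integrable lebesgue u \<Longrightarrow> AE x in lebesgue. T u x = T\<^sub>0 u x"
proof -
  assume "u \<in> L2_space" "v \<in> L2_space"
  then have "AE x in lebesgue. T (\<lambda>y. 1 * u y + (- 1) * v y) x = 1 * T u x + (- 1) * T v x"
    using assms unfolding L2_bounded_extension_def by blast
  then show "AE x in lebesgue. T (\<lambda>y. u y - v y) x = T u x - T v x"
    by simp
qed (use assms in \<open>auto simp: L2_bounded_extension_def\<close>)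

lemma L2_extension_tendsto:
  assumes T: "L2_bounded_extension T\<^sub>0 T" and f: "L2_tendsto f u"
  shows "L2_tendsto (\<lambda>n. T (f n)) (T u)"
proof -
  have fs: "f n \<in> L2_space" "u \<in> L2_space" for n
    using f by (auto simp: L2_tendsto_def)
  obtain C where C: "\<And>v. v \<in> L2_space \<Longrightarrow> L2_norm (T v) \<le> C * L2_norm v"
    using T unfolding L2_bounded_extension_def by blast
  have le: "L2_norm (\<lambda>x. T (f n) x - T u x) \<le> C * L2_norm (\<lambda>x. f n x - u x)" for n
  proof -
    have d: "(\<lambda>x. f n x - u x) \<in> L2_space"
      using fs by (rule L2_space_diff)
    have "L2_norm (T (\<lambda>x. f n x - u x)) = L2_norm (\<lambda>x. T (f n) x - T u x)"
      by (intro L2_norm_cong_AE L2_space_measurable L2_space_diff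
          L2_extension_diff[OF T] L2_extension_in_L2[OF T] d fs)
    then show ?thesis
      using C[OF d] by simp
  qed
  have "(\<lambda>n. C * L2_norm (\<lambda>x. f n x - u x)) \<longlonglongrightarrow> 0"
    using tendsto_mult_left[of "\<lambda>n. L2_norm (\<lambda>x. f n x - u x)" 0 sequentially C] f
    by (simp add: L2_tendsto_def)
  then have "(\<lambda>n. L2_norm (\<lambda>x. T (f n) x - T u x)) \<longlonglongrightarrow> 0"
    by (rule Lim_null_comparison[rotated]) (use le in auto)
  then show ?thesis
    using L2_extension_in_L2[OF T] fs by (simp add: L2_tendsto_def)
qed

text \<open>
  Every bounded extension is isometric, whatever bound its definition grants: extensions are
  continuous, and isometric on the dense set of continuous functions with compact support.
\<close>

theorem osc_extension_isometry:
  assumes T: "L2_bounded_extension (osc_integral \<sigma>) T" and \<sigma>: "\<bar>\<sigma>\<bar> = 1" and u: "u \<in> L2_space"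
  shows "L2_norm (T u) = L2_norm u"
proof -
  obtain f where f: "L2_tendsto f u" "\<And>n. cc_function (f n)"
    using cc_function_dense[OF u] by blast
  note f_int = cc_function_integrable[OF f(2)]
  have "L2_norm (T (f n)) = L2_norm (osc_integral \<sigma> (f n))" for n
    by (intro L2_norm_cong_AE L2_space_measurable L2_extension_eq[OF T] L2_extension_in_L2[OF T]
        osc_integral_bessel(1) f_int \<sigma>)
  then have "L2_norm (T (f n)) = L2_norm (f n)" for n
    using osc_integral_isometry_cc[OF f(2) \<sigma>] by simp
  then have "(\<lambda>n. L2_norm (f n)) \<longlonglongrightarrow> L2_norm (T u)"
    using L2_tendsto_norm[OF L2_extension_tendsto[OF T f(1)]] by simp
  then show ?thesis
    using L2_tendsto_norm[OF f(1)] by (rule LIMSEQ_unique)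
qed

lemma osc_extension_adjoint:
  assumes T: "L2_bounded_extension (osc_integral \<sigma>) T" and S: "L2_bounded_extension (osc_integral (- \<sigma>)) S"
    and \<sigma>: "\<bar>\<sigma>\<bar> = 1" and u: "u \<in> L2_space" and v: "v \<in> L2_space"
  shows "L2_inner (T u) v = L2_inner u (S v)"
proof -
  have \<sigma>': "\<bar>- \<sigma>\<bar> = 1"
    using \<sigma> by simp
  obtain f where f: "L2_tendsto f u" "\<And>n. cc_function (f n)"
    using cc_function_dense[OF u] by blast
  obtain g where g: "L2_tendsto g v" "\<And>n. cc_function (g n)"
    using cc_function_dense[OF v] by blast
  note f_int = cc_function_integrable[OF f(2)]
  note g_int = cc_function_integrable[OF g(2)]
  have "L2_inner (T (f n)) (g n) = L2_inner (f n) (S (g n))" for n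
  proof -
    have "L2_inner (T (f n)) (g n) = L2_inner (osc_integral \<sigma> (f n)) (g n)"
      by (intro L2_inner_cong_AE AE_I2 refl L2_extension_eq[OF T] L2_extension_in_L2[OF T]
          osc_integral_bessel(1) f_int g_int \<sigma>)
    also have "\<dots> = L2_inner (f n) (osc_integral (- \<sigma>) (g n))"
      by (rule osc_integral_adjoint[OF f_int(1) g_int(1)])
    also have "\<dots> = L2_inner (f n) (S (g n))"
      by (rule sym, intro L2_inner_cong_AE AE_I2 refl L2_extension_eq[OF S] L2_extension_in_L2[OF S]
          osc_integral_bessel(1) f_int g_int \<sigma>')
    finally show ?thesis .
  qed
  then have "(\<lambda>n. L2_inner (f n) (S (g n))) \<longlonglongrightarrow> L2_inner (T u) v"
    using L2_tendsto_inner[OF L2_extension_tendsto[OF T f(1)] g(1)] by simp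
  then show ?thesis
    using L2_tendsto_inner[OF f(1) L2_extension_tendsto[OF S g(1)]] by (rule LIMSEQ_unique)
qed

text \<open>
  For isometries \<open>S\<close> and \<open>T\<close> adjoint to each other,
  \<open>\<parallel>S T u - u\<parallel>\<^sup>2 = \<parallel>S T u\<parallel>\<^sup>2 - 2 Re \<langle>T u, T u\<rangle> + \<parallel>u\<parallel>\<^sup>2 = 0\<close>.
\<close>

theorem osc_extension_inverse:
  assumes T: "L2_bounded_extension (osc_integral \<sigma>) T" and S: "L2_bounded_extension (osc_integral (- \<sigma>)) S"
    and \<sigma>: "\<bar>\<sigma>\<bar> = 1" and u: "u \<in> L2_space"
  shows "AE x in lebesgue. S (T u) x = u x"
proof -
  have Tu: "T u \<in> L2_space" and STu: "S (T u) \<in> L2_space"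
    using u L2_extension_in_L2[OF T] L2_extension_in_L2[OF S] by auto
  have \<sigma>': "\<bar>- \<sigma>\<bar> = 1"
    using \<sigma> by simp
  have "L2_inner u (S (T u)) = of_real ((L2_norm u)\<^sup>2)"
    using osc_extension_adjoint[OF T S \<sigma> u Tu] by (simp add: L2_inner_self osc_extension_isometry[OF T \<sigma> u])
  then have "L2_inner (S (T u)) u = of_real ((L2_norm u)\<^sup>2)"
    by (simp add: L2_inner_commute[of "S (T u)" u])
  moreover have "L2_norm (S (T u)) = L2_norm u"
    using osc_extension_isometry[OF S \<sigma>' Tu] osc_extension_isometry[OF T \<sigma> u] by simp
  ultimately have "L2_norm (\<lambda>x. S (T u) x - u x) = 0"
    using L2_norm_diff_power2[OF STu u] by simp
  then show ?thesis
    using L2_norm_eq_0_iff[OF L2_space_diff[OF STu u]] by simp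
qed

lemma fourier_integral_eq_osc: "fourier_integral = osc_integral (- 1)"
  by (intro ext) (simp add: fourier_integral_def osc_integral_def cis_conv_exp mult_ac)

lemma inv_fourier_integral_eq_osc: "inv_fourier_integral = osc_integral 1"
  by (intro ext) (simp add: inv_fourier_integral_def osc_integral_def cis_conv_exp mult_ac)

lemma fourier_extension: "L2_bounded_extension (osc_integral (- 1)) fourier"
  unfolding fourier_def fourier_integral_eq_osc by (rule someI_ex[OF osc_bounded_extension_exists]) simp

lemma inv_fourier_extension: "L2_bounded_extension (osc_integral 1) inv_fourier"
  unfolding inv_fourier_def inv_fourier_integral_eq_osc
  by (rule someI_ex[OF osc_bounded_extension_exists]) simp

lemmas fourier_in_L2 = L2_extension_in_L2[OF fourier_extension]
lemmas inv_fourier_in_L2 = L2_extension_in_L2[OF inv_fourier_extension]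
lemmas fourier_diff = L2_extension_diff[OF fourier_extension]

lemma L2_norm_fourier: "u \<in> L2_space \<Longrightarrow> L2_norm (fourier u) = L2_norm u"
  by (rule osc_extension_isometry[OF fourier_extension]) simp

lemma fourier_inv_fourier: "u \<in> L2_space \<Longrightarrow> AE x in lebesgue. fourier (inv_fourier u) x = u x"
  using osc_extension_inverse[OF inv_fourier_extension fourier_extension] by simp

lemma inv_fourier_fourier: "u \<in> L2_space \<Longrightarrow> AE x in lebesgue. inv_fourier (fourier u) x = u x"
  using osc_extension_inverse[OF fourier_extension, of inv_fourier] inv_fourier_extension by simp

lemma parseval:
  assumes u: "u \<in> L2_space" and v: "v \<in> L2_space"
  shows "L2_inner (fourier u) (fourier v) = L2_inner u v"
proof -
  have "L2_inner (fourier u) (fourier v) = L2_inner u (inv_fourier (fourier v))"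
    using osc_extension_adjoint[OF fourier_extension, of inv_fourier u "fourier v"]
      inv_fourier_extension u fourier_in_L2[OF v] by simp
  also have "\<dots> = L2_inner u v"
    by (intro L2_inner_cong_AE AE_I2 refl inv_fourier_fourier inv_fourier_in_L2 fourier_in_L2 u v)
  finally show ?thesis .
qed

section \<open>Sobolev spaces and the adjoint of the embedding\<close>

lemma bessel_weight_base_ge_1: "1 \<le> 1 + 4 * pi\<^sup>2 * (norm \<xi>)\<^sup>2"
  by simp

lemma bessel_weight_pos: "0 < bessel_weight r \<xi>"
  using bessel_weight_base_ge_1[of \<xi>] unfolding bessel_weight_def by (intro powr_gt_zero[THEN iffD2]) linarith

lemma bessel_weight_add: "bessel_weight (r + s) \<xi> = bessel_weight r \<xi> * bessel_weight s \<xi>"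
  unfolding bessel_weight_def by (rule powr_add)

lemma bessel_weight_0 [simp]: "bessel_weight 0 \<xi> = 1"
proof -
  have "1 + 4 * pi\<^sup>2 * (norm \<xi>)\<^sup>2 \<noteq> 0"
    using bessel_weight_base_ge_1[of \<xi>] by linarith
  then show ?thesis
    by (simp add: bessel_weight_def)
qed

lemma bessel_weight_le_1: "r \<le> 0 \<Longrightarrow> bessel_weight r \<xi> \<le> 1"
  using powr_mono[of r 0 "1 + 4 * pi\<^sup>2 * (norm \<xi>)\<^sup>2"] bessel_weight_0[of \<xi>]
  by (simp add: bessel_weight_def)

lemma bessel_weight_measurable: "(\<lambda>\<xi>::'a::euclidean_space. complex_of_real (bessel_weight r \<xi>)) \<in> borel_measurable lebesgue"
proof (rule borel_imp_lebesgue_measurable)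
  show "(\<lambda>\<xi>::'a. complex_of_real (bessel_weight r \<xi>)) \<in> borel_measurable borel"
    unfolding bessel_weight_def by measurable
qed

lemma L2_space_cong_AE:
  assumes "u \<in> L2_space" "v \<in> borel_measurable lebesgue" "AE x in lebesgue. v x = u x"
  shows "v \<in> L2_space"
proof -
  have "integrable lebesgue (\<lambda>x. (cmod (v x))\<^sup>2)"
    using L2_space_integrable_square[OF assms(1)] L2_space_measurable[OF assms(1)] assms(2,3)
    by (subst integrable_cong_AE[where g="\<lambda>x. (cmod (u x))\<^sup>2"]) auto
  then show ?thesis
    using assms(2) by (simp add: L2_space_def)
qed

lemma sobolev_space_iff:
  "u \<in> sobolev_space s \<longleftrightarrow>
    u \<in> L2_space \<and> (\<lambda>\<xi>. of_real (bessel_weight (s / 2) \<xi>) * fourier u \<xi>) \<in> L2_space"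
  by (auto simp: sobolev_space_def inv_fourier_in_L2)

lemma sobolev_inner_eq_L2_inner:
  "sobolev_inner s u v =
    L2_inner (\<lambda>\<xi>. of_real (bessel_weight (s / 2) \<xi>) * fourier u \<xi>)
      (\<lambda>\<xi>. of_real (bessel_weight (s / 2) \<xi>) * fourier v \<xi>)"
proof -
  have "bessel_weight s \<xi> = bessel_weight (s / 2) \<xi> * bessel_weight (s / 2) \<xi>" for \<xi> :: 'a
    using bessel_weight_add[of "s / 2" "s / 2" \<xi>] by simp
  then show ?thesis
    by (simp add: sobolev_inner_def L2_inner_def mult_ac)
qed

lemma weighted_fourier_measurable:
  "u \<in> L2_space \<Longrightarrow> (\<lambda>\<xi>. of_real (bessel_weight r \<xi>) * fourier u \<xi>) \<in> borel_measurable lebesgue"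
  by (intro borel_measurable_times bessel_weight_measurable L2_space_measurable fourier_in_L2)

text \<open>
  The inner product of \<open>H\<^sup>s\<close> separates points: testing with the difference \<open>d = w - w'\<close> itself shows
  that its weighted transform \<open>W d\<close> vanishes almost everywhere, and the weight is positive.
\<close>

lemma sobolev_riesz_unique_AE:
  assumes w: "w \<in> sobolev_space s" "w' \<in> sobolev_space s"
    and eq: "\<And>v. v \<in> sobolev_space s \<Longrightarrow> sobolev_inner s w v = sobolev_inner s w' v"
  shows "AE x in lebesgue. w x = w' x"
proof -
  define W where "W v \<xi> = complex_of_real (bessel_weight (s / 2) \<xi>) * fourier v \<xi>" for v :: "'a \<Rightarrow> complex" and \<xi>
  define d where "d x = w x - w' x" for x
  have wL: "w \<in> L2_space" "w' \<in> L2_space" and WL: "W w \<in> L2_space" "W w' \<in> L2_space"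
    using w by (auto simp: sobolev_space_iff W_def[abs_def])
  have dL: "d \<in> L2_space"
    unfolding d_def[abs_def] by (rule L2_space_diff[OF wL])
  have "AE \<xi> in lebesgue. W d \<xi> = W w \<xi> - W w' \<xi>"
    using fourier_diff[OF wL] by eventually_elim (simp only: W_def d_def[abs_def] right_diff_distrib)
  moreover have "W d \<in> borel_measurable lebesgue"
    unfolding W_def[abs_def] by (rule weighted_fourier_measurable[OF dL])
  ultimately have WdL: "W d \<in> L2_space" and Wd: "AE \<xi> in lebesgue. W d \<xi> = W w \<xi> - W w' \<xi>"
    using L2_space_cong_AE[OF L2_space_diff[OF WL]] by auto
  have "d \<in> sobolev_space s"
    using dL WdL by (simp add: sobolev_space_iff W_def[abs_def])
  from eq[OF this] have "L2_inner (W w) (W d) = L2_inner (W w') (W d)"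
    by (simp add: sobolev_inner_eq_L2_inner W_def[abs_def])
  then have "L2_inner (\<lambda>\<xi>. W w \<xi> - W w' \<xi>) (W d) = 0"
    using L2_inner_diff_left[OF WL WdL] by simp
  moreover have "L2_inner (W d) (W d) = L2_inner (\<lambda>\<xi>. W w \<xi> - W w' \<xi>) (W d)"
    by (intro L2_inner_cong_AE Wd AE_I2 refl WdL L2_space_diff WL)
  ultimately have "L2_norm (W d) = 0"
    by (simp add: L2_inner_self)
  then have "AE \<xi> in lebesgue. W d \<xi> = 0"
    using L2_norm_eq_0_iff[OF WdL] by simp
  then have "AE \<xi> in lebesgue. fourier d \<xi> = 0"
  proof eventually_elim
    case (elim \<xi>)
    then show ?case
      using bessel_weight_pos[of "s / 2" \<xi>] by (simp add: W_def)
  qed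
  then have "L2_norm (fourier d) = 0"
    using L2_norm_eq_0_iff[OF fourier_in_L2[OF dL]] by simp
  then have "L2_norm d = 0"
    by (simp add: L2_norm_fourier[OF dL])
  then show ?thesis
    using L2_norm_eq_0_iff[OF dL] by (simp add: d_def)
qed

text \<open>
  The weight in \<open>\<langle>w, v\<rangle>\<close> cancels the factor \<open>(1 + 4\<pi>\<^sup>2\<bar>\<xi>\<bar>\<^sup>2)\<^sup>-\<^sup>s\<close> of \<open>\<F> w\<close>, which leaves
  \<open>\<langle>\<F> u, \<F> v\<rangle>\<close>. Membership of \<open>w\<close> in \<open>H\<^sup>s\<close> uses \<open>s \<ge> 0\<close>: both \<open>(1 + 4\<pi>\<^sup>2\<bar>\<xi>\<bar>\<^sup>2)\<^sup>-\<^sup>s\<close> and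
  its square root are bounded by 1.
\<close>

lemma sobolev_riesz_representative:
  fixes u :: "'a::euclidean_space \<Rightarrow> complex"
  assumes s: "0 \<le> s" and u: "u \<in> L2_space"
  defines "w \<equiv> inv_fourier (\<lambda>\<xi>. of_real (bessel_weight (- s) \<xi>) * fourier u \<xi>)"
  shows "w \<in> sobolev_space s" "v \<in> sobolev_space s \<Longrightarrow> sobolev_inner s w v = L2_inner u v"
proof -
  have damped: "(\<lambda>\<xi>. of_real (bessel_weight r \<xi>) * fourier u \<xi>) \<in> L2_space" if "r \<le> 0" for r
  proof (rule L2_space_bounded_mult[OF fourier_in_L2[OF u] bessel_weight_measurable])
    show "cmod (of_real (bessel_weight r \<xi>)) \<le> 1" for \<xi> :: 'a
      using bessel_weight_le_1[OF that, of \<xi>] bessel_weight_pos[of r \<xi>] by simp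
  qed
  have s0: "- s \<le> 0" "- s / 2 \<le> 0"
    using s by auto
  have wL: "w \<in> L2_space"
    unfolding w_def by (rule inv_fourier_in_L2[OF damped[OF s0(1)]])
  have Fw: "AE \<xi> in lebesgue. fourier w \<xi> = of_real (bessel_weight (- s) \<xi>) * fourier u \<xi>"
    unfolding w_def by (rule fourier_inv_fourier[OF damped[OF s0(1)]])
  have half: "AE \<xi> in lebesgue. of_real (bessel_weight (s / 2) \<xi>) * fourier w \<xi> =
      of_real (bessel_weight (- s / 2) \<xi>) * fourier u \<xi>"
    using Fw
  proof eventually_elim
    case (elim \<xi>)
    have "bessel_weight (s / 2) \<xi> * bessel_weight (- s) \<xi> = bessel_weight (- s / 2) \<xi>"
      using bessel_weight_add[of "s / 2" "- s" \<xi>] by simp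
    then show ?case
      by (simp only: elim mult.assoc[symmetric] of_real_mult[symmetric])
  qed
  have "(\<lambda>\<xi>. of_real (bessel_weight (s / 2) \<xi>) * fourier w \<xi>) \<in> L2_space"
    by (rule L2_space_cong_AE[OF damped[OF s0(2)] weighted_fourier_measurable[OF wL] half])
  then show "w \<in> sobolev_space s"
    using wL by (simp add: sobolev_space_iff)
  assume v: "v \<in> sobolev_space s"
  then have vL: "v \<in> L2_space"
    by (simp add: sobolev_space_iff)
  have "sobolev_inner s w v = L2_inner (fourier u) (fourier v)"
    unfolding sobolev_inner_def L2_inner_def
  proof (rule integral_cong_AE)
    show "AE \<xi> in lebesgue. of_real (bessel_weight s \<xi>) * fourier w \<xi> * cnj (fourier v \<xi>) =
        fourier u \<xi> * cnj (fourier v \<xi>)"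
      using Fw
    proof eventually_elim
      case (elim \<xi>)
      have "bessel_weight s \<xi> * bessel_weight (- s) \<xi> = 1"
        using bessel_weight_add[of s "- s" \<xi>] by simp
      then show ?case
        by (simp only: elim mult.assoc[symmetric] of_real_mult[symmetric]) simp
    qed
    show "(\<lambda>\<xi>. of_real (bessel_weight s \<xi>) * fourier w \<xi> * cnj (fourier v \<xi>)) \<in> borel_measurable lebesgue"
      by (intro borel_measurable_times borel_measurable_cnj bessel_weight_measurable
          L2_space_measurable fourier_in_L2 wL vL)
    show "(\<lambda>\<xi>. fourier u \<xi> * cnj (fourier v \<xi>)) \<in> borel_measurable lebesgue"
      by (intro borel_measurable_times borel_measurable_cnj L2_space_measurable fourier_in_L2 u vL)
  qed
  then show "sobolev_inner s w v = L2_inner u v"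
    by (simp add: parseval[OF u vL])
qed

theorem proposition4p1:
  fixes s :: real and u :: "real ^ 'n \<Rightarrow> complex"
  assumes "0 \<le> s" and "u \<in> L2_space"
  shows "AE x in lebesgue. sobolev_embedding_adjoint s u x =
    inv_fourier (\<lambda>\<xi>. of_real (bessel_weight (- s) \<xi>) * fourier u \<xi>) x"
proof -
  define w where "w = inv_fourier (\<lambda>\<xi>. of_real (bessel_weight (- s) \<xi>) * fourier u \<xi>)"
  define is_adjoint where "is_adjoint z \<longleftrightarrow> z \<in> sobolev_space s \<and>
    (\<forall>v\<in>sobolev_space s. sobolev_inner s z v = L2_inner u (sobolev_embedding s v))" for z
  have w: "is_adjoint w"
    using sobolev_riesz_representative[OF assms]
    by (simp add: is_adjoint_def w_def sobolev_embedding_def)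
  then have "is_adjoint (sobolev_embedding_adjoint s u)"
    unfolding sobolev_embedding_adjoint_def is_adjoint_def[symmetric] by (rule someI[of is_adjoint])
  with w have "AE x in lebesgue. sobolev_embedding_adjoint s u x = w x"
    unfolding is_adjoint_def by (intro sobolev_riesz_unique_AE) auto
  then show ?thesis
    by (simp add: w_def)
qed

end
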